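(* Let $H=\mathrm{Symp}(D)$ be the group of symplectomorphisms of the closed unit disk $D$ and let $p:H\to \mathrm{Diff}_+(S^1)$ be the restriction to $S^1=\partial D$. The ILM cocycle $C_{\eta,x_0}\in C^2(H;\mathbb{R})$, where $\eta=(x\,dy-y\,dx)/2$ and $x_0=(1,0)$, is basic, that is, there exists a $2$-cocycle $\chi$ on $\mathrm{Diff}_+(S^1)$ with values in $\mathbb{R}$ such that $C_{\eta,x_0}=p^*\chi$. Furthermore, the cohomology class $[\chi]\in H^2(\mathrm{Diff}_+(S^1);\mathbb{R})$ is equal to $\pi e_{\mathbb{R}}$.
   Context: $D=\{(x,y)\in\mathbb{R}^2 \mid x^2+y^2\le 1\}$ has symplectic form $\omega = dx\wedge dy=d\eta$, and $H=\mathrm{Symp}(D)=\{g\in\mathrm{Diff}(D)\mid g^*\omega=\omega\}$. $\mathrm{Diff}_+(S^1)$ is the group of orientation-preserving smooth diffeomorphisms of $S^1=\partial D$ (as a discrete group). The ILM (Ismagilov–Losik–Michor) cocycle is the group $2$-cocycle (trivial coefficients $\mathbb{R}$) $$C_{\eta,x_0}(g,h)=\int_{x_0}^{h(x_0)}(g^*\eta-\eta),\qquad g,h\in H,$$ where the integral is along any path in $D$ from $x_0$ to $h(x_0)$ (the integrand is closed and $D$ is simply connected). The class $e_{\mathbb{R}}\in H^2(\mathrm{Diff}_+(S^1);\mathbb{R})$ is the (real) Euler class of the central extension $0\to\mathbb{Z}\to\widetilde{\mathrm{Diff}_+(S^1)}\to \mathrm{Diff}_+(S^1)\to 1$, where $\widetilde{\mathrm{Diff}_+(S^1)}$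 is the group of orientation-preserving diffeomorphisms $\varphi$ of $\mathbb{R}$ with $\varphi(x+2\pi)=\varphi(x)+2\pi$, and $S^1=\mathbb{R}/2\pi\mathbb{Z}$ via the angle coordinate. With the sign convention used here it is represented by the cocycle $(\mu,\nu)\mapsto \frac{1}{2\pi}(\varphi\psi(0)-\varphi(0)-\psi(0))$, where $\varphi,\psi\in\widetilde{\mathrm{Diff}_+(S^1)}$ are any lifts of $\mu,\nu$. *)

theory Defs
  imports "HOL-Analysis.Analysis" "HOL-Algebra.Bij" "HOL-Algebra.Coset"
begin

section \<open>Degree-two group cohomology with trivial coefficients\<close>

definition cocycles2 :: "('a, 'm) monoid_scheme \<Rightarrow> ('a \<times> 'a \<Rightarrow> 'b::ab_group_add) set" where
  "cocycles2 G = {c \<in> extensional (carrier G \<times> carrier G).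
     \<forall>g\<in>carrier G. \<forall>h\<in>carrier G. \<forall>k\<in>carrier G.
       c (h, k) - c (g \<otimes>\<^bsub>G\<^esub> h, k) + c (g, h \<otimes>\<^bsub>G\<^esub> k) - c (g, h) = 0}"

definition coboundaries2 :: "('a, 'm) monoid_scheme \<Rightarrow> ('a \<times> 'a \<Rightarrow> 'b::ab_group_add) set" where
  "coboundaries2 G =
     range (\<lambda>f. \<lambda>(g, h)\<in>carrier G \<times> carrier G. f h - f (g \<otimes>\<^bsub>G\<^esub> h) + f g)"

definition cocycle2_group ::
  "('a, 'm) monoid_scheme \<Rightarrow> ('a \<times> 'a \<Rightarrow> 'b::ab_group_add) monoid" where
  "cocycle2_group G = \<lparr>
     carrier = cocycles2 G,
     mult = (\<lambda>c d. \<lambda>x\<in>carrier G \<times> carrier G. c x + d x),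
     one = (\<lambda>x\<in>carrier G \<times> carrier G. 0)\<rparr>"

text \<open>The class of a cocycle, an element of \<open>cocycle2_group G Mod coboundaries2 G\<close>.\<close>

definition H2_class ::
  "('a, 'm) monoid_scheme \<Rightarrow> ('a \<times> 'a \<Rightarrow> 'b::ab_group_add) \<Rightarrow> ('a \<times> 'a \<Rightarrow> 'b) set" where
  "H2_class G c = coboundaries2 G #>\<^bsub>cocycle2_group G\<^esub> c"

text \<open>The map on second cohomology induced by an additive map \<open>t\<close> of the coefficients. For
  \<open>t = real_of_int\<close> it is the change of coefficients from the integers to the reals; for
  \<open>t = (*) r\<close> with \<open>r\<close> real it is scalar multiplication by \<open>r\<close>.\<close>

definition H2_coeff_map ::
  "('a, 'm) monoid_scheme \<Rightarrow> ('b::ab_group_add \<Rightarrow> 'c::ab_group_add)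
     \<Rightarrow> ('a \<times> 'a \<Rightarrow> 'b) set \<Rightarrow> ('a \<times> 'a \<Rightarrow> 'c) set" where
  "H2_coeff_map G t X = (\<Union>c\<in>X. H2_class G (\<lambda>x\<in>carrier G \<times> carrier G. t (c x)))"

definition pullback_cochain2 ::
  "('a, 'm) monoid_scheme \<Rightarrow> ('a \<Rightarrow> 'd) \<Rightarrow> ('d \<times> 'd \<Rightarrow> 'b) \<Rightarrow> ('a \<times> 'a \<Rightarrow> 'b)" where
  "pullback_cochain2 G p c = (\<lambda>(g, h)\<in>carrier G \<times> carrier G. c (p g, p h))"

subsection \<open>The class of a central extension by the integers\<close>

text \<open>In the following, \<open>i\<close> is the inclusion of the integers into \<open>E\<close> and \<open>q\<close> is the projection
  from \<open>E\<close> onto \<open>G\<close>.\<close>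

definition set_section ::
  "('a, 'm) monoid_scheme \<Rightarrow> ('e, 'n) monoid_scheme \<Rightarrow> ('e \<Rightarrow> 'a) \<Rightarrow> ('a \<Rightarrow> 'e) \<Rightarrow> bool" where
  "set_section G E q s \<longleftrightarrow> s \<in> carrier G \<rightarrow> carrier E \<and> (\<forall>g\<in>carrier G. q (s g) = g)"

definition extension_cocycle ::
  "('a, 'm) monoid_scheme \<Rightarrow> ('e, 'n) monoid_scheme \<Rightarrow> (int \<Rightarrow> 'e) \<Rightarrow> ('a \<Rightarrow> 'e)
     \<Rightarrow> ('a \<times> 'a \<Rightarrow> int)" where
  "extension_cocycle G E i s = (\<lambda>(g, h)\<in>carrier G \<times> carrier G.
     THE n. s g \<otimes>\<^bsub>E\<^esub> s h = i n \<otimes>\<^bsub>E\<^esub> s (g \<otimes>\<^bsub>G\<^esub> h))"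

text \<open>The class does not depend on the choice of the section.\<close>

definition extension_class ::
  "('a, 'm) monoid_scheme \<Rightarrow> ('e, 'n) monoid_scheme \<Rightarrow> (int \<Rightarrow> 'e) \<Rightarrow> ('e \<Rightarrow> 'a)
     \<Rightarrow> ('a \<times> 'a \<Rightarrow> int) set" where
  "extension_class G E i q = H2_class G (extension_cocycle G E i (SOME s. set_section G E q s))"


section \<open>Smooth maps and diffeomorphism groups\<close>

text \<open>Only meaningful for open \<open>U\<close>.\<close>

fun Ck_on :: "nat \<Rightarrow> ('a::real_normed_vector \<Rightarrow> 'b::real_normed_vector) \<Rightarrow> 'a set \<Rightarrow> bool" where
  "Ck_on 0 f U \<longleftrightarrow> continuous_on U f"
| "Ck_on (Suc k) f U \<longleftrightarrow> (\<forall>x\<in>U. f differentiable (at x)) \<and>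
     (\<forall>v. Ck_on k (\<lambda>x. frechet_derivative f (at x) v) U)"

text \<open>Smoothness on an arbitrary subset of a Euclidean space: locally the restriction of a smooth
  map defined on an open set. On the closed disk this is smoothness up to the boundary, and on the
  circle it is smoothness on an embedded submanifold.\<close>

definition smooth_on :: "'a::euclidean_space set \<Rightarrow> ('a \<Rightarrow> 'b::euclidean_space) \<Rightarrow> bool" where
  "smooth_on S f \<longleftrightarrow> (\<forall>x\<in>S. \<exists>U F. open U \<and> x \<in> U \<and> (\<forall>k. Ck_on k F U) \<and> (\<forall>y\<in>S \<inter> U. F y = f y))"

definition Diff :: "'a::euclidean_space set \<Rightarrow> ('a \<Rightarrow> 'a) set" where
  "Diff S = {f \<in> Bij S. smooth_on S f \<and> smooth_on S (inv_into S f)}"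


section \<open>Symplectomorphisms of the closed unit disk\<close>

text \<open>The plane is \<open>complex\<close>, with \<open>x = Re z\<close> and \<open>y = Im z\<close>. A one-form takes a point and a
  tangent vector, a two-form a point and two tangent vectors.\<close>

abbreviation disk :: "complex set" where "disk \<equiv> cball 0 1"

abbreviation circle :: "complex set" where "circle \<equiv> sphere 0 1"

definition area_form :: "complex \<Rightarrow> complex \<Rightarrow> complex \<Rightarrow> real" where
  "area_form z u v = Re u * Im v - Im u * Re v"

definition eta_form :: "complex \<Rightarrow> complex \<Rightarrow> real" where
  "eta_form z v = (Re z * Im v - Im z * Re v) / 2"

definition pullback1 ::
  "(complex \<Rightarrow> complex) \<Rightarrow> (complex \<Rightarrow> complex \<Rightarrow> real) \<Rightarrow> (complex \<Rightarrow> complex \<Rightarrow> real)" where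
  "pullback1 g \<alpha> z v = \<alpha> (g z) (frechet_derivative g (at z within disk) v)"

definition pullback2 ::
  "(complex \<Rightarrow> complex) \<Rightarrow> (complex \<Rightarrow> complex \<Rightarrow> complex \<Rightarrow> real)
     \<Rightarrow> (complex \<Rightarrow> complex \<Rightarrow> complex \<Rightarrow> real)" where
  "pullback2 g \<beta> z u v = \<beta> (g z) (frechet_derivative g (at z within disk) u)
                                 (frechet_derivative g (at z within disk) v)"

text \<open>Multiplication in \<open>BijGroup\<close> is composition, with the right factor applied first.\<close>

definition Symp_disk :: "(complex \<Rightarrow> complex) monoid" where
  "Symp_disk = (BijGroup disk)
     \<lparr>carrier := {g \<in> Diff disk. \<forall>z\<in>disk. pullback2 g area_form z = area_form z}\<rparr>"

definition has_line_integral ::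
  "(complex \<Rightarrow> complex \<Rightarrow> real) \<Rightarrow> real \<Rightarrow> (real \<Rightarrow> complex) \<Rightarrow> bool" where
  "has_line_integral \<alpha> c \<gamma> \<longleftrightarrow>
     ((\<lambda>t. \<alpha> (\<gamma> t) (vector_derivative \<gamma> (at t within {0..1}))) has_integral c) {0..1}"

text \<open>The value is the common integral along all piecewise continuously differentiable paths
  in the disk.\<close>

definition ILM_cocycle ::
  "(complex \<Rightarrow> complex \<Rightarrow> real) \<Rightarrow> complex
     \<Rightarrow> ((complex \<Rightarrow> complex) \<times> (complex \<Rightarrow> complex) \<Rightarrow> real)" where
  "ILM_cocycle \<eta> x0 = (\<lambda>(g, h)\<in>carrier Symp_disk \<times> carrier Symp_disk.
     THE c. \<forall>\<gamma>. valid_path \<gamma> \<and> path_image \<gamma> \<subseteq> disk \<and> pathstart \<gamma> = x0 \<and> pathfinish \<gamma> = h x0 \<longrightarrow>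
       has_line_integral (\<lambda>z v. pullback1 g \<eta> z v - \<eta> z v) c \<gamma>)"


section \<open>Diffeomorphisms of the circle and the Euler class\<close>

text \<open>The positive unit tangent vector of the circle at \<open>w\<close> is \<open>\<i> * w\<close>.\<close>

definition Diff_plus_circle :: "(complex \<Rightarrow> complex) monoid" where
  "Diff_plus_circle = (BijGroup circle)
     \<lparr>carrier := {\<mu> \<in> Diff circle. \<forall>t::real. \<exists>a>0.
        ((\<lambda>s. \<mu> (cis s)) has_vector_derivative a *\<^sub>R (\<i> * \<mu> (cis t))) (at t)}\<rparr>"

definition boundary_restriction :: "(complex \<Rightarrow> complex) \<Rightarrow> (complex \<Rightarrow> complex)" where
  "boundary_restriction g = restrict g circle"

definition Diff_plus_cover :: "(real \<Rightarrow> real) monoid" where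
  "Diff_plus_cover = (BijGroup UNIV)
     \<lparr>carrier := {\<phi> \<in> Diff UNIV. (\<forall>x. deriv \<phi> x > 0) \<and> (\<forall>x. \<phi> (x + 2 * pi) = \<phi> x + 2 * pi)}\<rparr>"

definition cover_inclusion :: "int \<Rightarrow> (real \<Rightarrow> real)" where
  "cover_inclusion n = (\<lambda>x. x + 2 * pi * of_int n)"

definition cover_projection :: "(real \<Rightarrow> real) \<Rightarrow> (complex \<Rightarrow> complex)" where
  "cover_projection \<phi> = (\<lambda>z\<in>circle. cis (\<phi> (Arg z)))"

text \<open>Sign convention: if \<open>\<phi>\<close>, \<open>\<psi>\<close>, \<open>\<rho>\<close> are the values of the section at \<open>\<mu>\<close>, \<open>\<nu>\<close>, \<open>\<mu>\<nu>\<close> and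
  \<open>\<phi> \<circ> \<psi> = \<rho> + 2 * pi * n\<close>, the extension cocycle has value \<open>n\<close>. It differs from
  \<open>(\<phi> (\<psi> 0) - \<phi> 0 - \<psi> 0) / (2 * pi)\<close> by the coboundary
  \<open>f \<nu> - f (\<mu>\<nu>) + f \<mu>\<close> with \<open>f\<close> the value of the section at \<open>0\<close> divided by \<open>2 * pi\<close>; hence
  the latter expression, which is the same for all choices of lifts, represents the same real
  class.\<close>

definition euler_class ::
  "((complex \<Rightarrow> complex) \<times> (complex \<Rightarrow> complex) \<Rightarrow> int) set" where
  "euler_class =
     extension_class Diff_plus_circle Diff_plus_cover cover_inclusion cover_projection"

definition real_euler_class ::
  "((complex \<Rightarrow> complex) \<times> (complex \<Rightarrow> complex) \<Rightarrow> real) set" where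
  "real_euler_class = H2_coeff_map Diff_plus_circle real_of_int euler_class"

end

theory Submission
  imports Defs
begin

text \<open>
  The one-form \<open>\<theta> = g\<^sup>* \<eta> - \<eta>\<close> is closed and smooth up to the boundary, so it has a primitive \<open>P\<close> on
  the disk (integrate along rays from the origin), and \<open>C (g, h) = P (h 1) - P 1\<close>. A symplectomorphism
  of the disk preserves the circle, on which \<open>\<eta>\<close> restricts to half the angle form. Hence
  if \<open>\<phi>\<close> and \<open>\<psi>\<close> lift the boundary values of \<open>g\<close> and \<open>h\<close>, then \<open>P (cis s) - (\<phi> s - s) / 2\<close> is constant in
  \<open>s\<close>, and with \<open>h 1 = cis (\<psi> 0)\<close> one gets \<open>C (g, h) = (\<phi> (\<psi> 0) - \<phi> 0 - \<psi> 0) / 2\<close>. This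
  expression only involves the boundary values. If \<open>\<rho>\<close> is the chosen lift of the product and
  \<open>\<phi> \<circ> \<psi> = \<rho> + 2 \<pi> n\<close>, it equals \<open>\<pi> n + (\<rho> 0 - \<phi> 0 - \<psi> 0) / 2\<close>, which is \<open>\<pi>\<close> times the
  extension cocycle plus a coboundary.
\<close>

section \<open>Calculus of smooth maps\<close>

lemma Ck_on_subset: "Ck_on k f U \<Longrightarrow> V \<subseteq> U \<Longrightarrow> Ck_on k f V"
  by (induction k arbitrary: f) (auto intro: continuous_on_subset)

text \<open>On an open set, functions that agree also share their derivatives at every point, so
  agreement passes down through all orders.\<close>

lemma Ck_on_cong:
  assumes "open U" "\<And>x. x \<in> U \<Longrightarrow> f x = g x" "Ck_on k f U"
  shows "Ck_on k g U"
  using assms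
proof (induction k arbitrary: f g)
  case 0
  then show ?case by (simp cong: continuous_on_cong)
next
  case (Suc k)
  have eq: "frechet_derivative f (at x) = frechet_derivative g (at x)" if "x \<in> U" for x
    using frechet_derivative_transform_within_open[of f x U g] Suc.prems that by simp
  have "g differentiable (at x)" if "x \<in> U" for x
    using Suc.prems that
    by (metis Ck_on.simps(2) differentiable_def has_derivative_transform_within_open)
  moreover have "Ck_on k (\<lambda>x. frechet_derivative g (at x) v) U" for v
    using Suc.IH[of "\<lambda>x. frechet_derivative f (at x) v"] Suc.prems eq by simp
  ultimately show ?case by simp
qed

text \<open>Derivatives at a point are unique, so an explicitly known derivative may replace the
  chosen value \<open>frechet_derivative\<close>. The smoothness proofs below then only need
  differentiation rules.\<close>

lemma Ck_on_SucI:
  assumes "open U" "\<And>x. x \<in> U \<Longrightarrow> (f has_derivative f' x) (at x)"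
    "\<And>v. Ck_on k (\<lambda>x. f' x v) U"
  shows "Ck_on (Suc k) f U"
proof -
  have "frechet_derivative f (at x) = f' x" if "x \<in> U" for x
    using assms(2)[OF that] by (metis frechet_derivative_at)
  then have "Ck_on k (\<lambda>x. frechet_derivative f (at x) v) U" for v
    using Ck_on_cong[OF assms(1) _ assms(3)[of v]] by simp
  then show ?thesis
    using assms(2) by (auto simp: differentiable_def)
qed

lemma Ck_on_SucD:
  "Ck_on (Suc k) f U \<Longrightarrow> x \<in> U \<Longrightarrow> (f has_derivative frechet_derivative f (at x)) (at x)"
  "Ck_on (Suc k) f U \<Longrightarrow> Ck_on k (\<lambda>x. frechet_derivative f (at x) v) U"
  by (simp_all add: frechet_derivative_works)

lemma Ck_on_Suc_imp: "Ck_on (Suc k) f U \<Longrightarrow> Ck_on k f U"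
proof (induction k arbitrary: f)
  case 0
  then show ?case
    by (auto intro!: continuous_at_imp_continuous_on differentiable_imp_continuous_within)
next
  case (Suc k)
  from Suc.prems show ?case
    using Suc.IH by (auto simp del: Ck_on.simps(2) simp: Ck_on.simps(2)[of "Suc k"] Ck_on.simps(2)[of "k" f])
qed

lemma Ck_on_imp_continuous_on: "Ck_on k f U \<Longrightarrow> continuous_on U f"
  by (induction k) (auto dest: Ck_on_Suc_imp simp del: Ck_on.simps(2))

lemma Ck_on_const: "open U \<Longrightarrow> Ck_on k (\<lambda>x. c) U"
proof (induction k arbitrary: c)
  case (Suc k)
  show ?case
    by (rule Ck_on_SucI[where f'="\<lambda>_ _. 0"]) (use Suc in auto)
qed simp

lemma Ck_on_bounded_linear:
  assumes "open U" "bounded_linear f"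
  shows "Ck_on k f U"
proof (cases k)
  case 0
  then show ?thesis using assms by (simp add: linear_continuous_on)
next
  case (Suc l)
  show ?thesis unfolding Suc
    by (rule Ck_on_SucI[where f'="\<lambda>_. f"])
      (use assms Ck_on_const bounded_linear_imp_has_derivative in auto)
qed

lemma Ck_on_add:
  assumes "open U" "Ck_on k f U" "Ck_on k g U"
  shows "Ck_on k (\<lambda>x. f x + g x) U"
  using assms(2,3)
proof (induction k arbitrary: f g)
  case 0
  then show ?case by (auto intro: continuous_intros)
next
  case (Suc k)
  note f = Ck_on_SucD[OF Suc.prems(1)] and g = Ck_on_SucD[OF Suc.prems(2)]
  show ?case
    by (rule Ck_on_SucI[OF assms(1) has_derivative_add[OF f(1) g(1)]])
      (assumption | rule Suc.IH[OF f(2) g(2)])+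
qed

lemma Ck_on_sum:
  assumes "open U" "finite I" "\<And>i. i \<in> I \<Longrightarrow> Ck_on k (f i) U"
  shows "Ck_on k (\<lambda>x. \<Sum>i\<in>I. f i x) U"
  using assms(2,3) by (induction I) (auto intro: Ck_on_add Ck_on_const assms(1))

text \<open>By the product rule the derivative is a sum of two terms of the same shape, each pairing
  a derivative with an undifferentiated factor that is still of class \<open>k\<close>.\<close>

lemma Ck_on_bounded_bilinear:
  assumes "bounded_bilinear bil" "open U" "Ck_on k f U" "Ck_on k g U"
  shows "Ck_on k (\<lambda>x. bil (f x) (g x)) U"
  using assms(3,4)
proof (induction k arbitrary: f g)
  case 0
  then show ?case by (auto intro: bounded_bilinear.continuous_on[OF assms(1)])
next
  case (Suc k)
  note f = Ck_on_SucD[OF Suc.prems(1)] and g = Ck_on_SucD[OF Suc.prems(2)]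
  show ?case
    by (rule Ck_on_SucI[OF assms(2) bounded_bilinear.FDERIV[OF assms(1) f(1) g(1)]])
      (assumption | intro Ck_on_add[OF assms(2)] Suc.IH f(2) g(2)
        Ck_on_Suc_imp[OF Suc.prems(1)] Ck_on_Suc_imp[OF Suc.prems(2)])+
qed

text \<open>In the chain rule the derivative of \<open>g\<close> is taken in a direction that varies
  with \<open>x\<close>, whereas \<open>Ck_on\<close> controls fixed directions only. Expanding that
  direction in the finite basis of the middle space gives a sum of products to which the induction
  hypothesis applies.\<close>

lemma Ck_on_compose:
  fixes f :: "'a::real_normed_vector \<Rightarrow> 'b::euclidean_space"
    and g :: "'b \<Rightarrow> 'c::real_normed_vector"
  assumes "open U" "f ` U \<subseteq> V" "Ck_on k f U" "Ck_on k g V"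
  shows "Ck_on k (\<lambda>x. g (f x)) U"
  using assms(3,4)
proof (induction k arbitrary: g)
  case 0
  then show ?case using assms(2) by (auto intro: continuous_on_compose2)
next
  case (Suc k)
  let ?f' = "\<lambda>x. frechet_derivative f (at x)" and ?g' = "\<lambda>y. frechet_derivative g (at y)"
  have f': "(f has_derivative ?f' x) (at x)" if "x \<in> U" for x
    using Ck_on_SucD(1)[OF Suc.prems(1) that] .
  have g': "(g has_derivative ?g' (f x)) (at (f x))" if "x \<in> U" for x
    using Ck_on_SucD(1)[OF Suc.prems(2)] that assms(2) by blast
  have lin: "?g' (f x) w = (\<Sum>i\<in>Basis. (w \<bullet> i) *\<^sub>R ?g' (f x) i)" if "x \<in> U" for x w
  proof -
    note lin = has_derivative_linear[OF g'[OF that]]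
    have "?g' (f x) w = ?g' (f x) (\<Sum>i\<in>Basis. (w \<bullet> i) *\<^sub>R i)"
      by (simp add: euclidean_representation)
    then show ?thesis by (simp add: linear_sum[OF lin] linear_scale[OF lin])
  qed
  show ?case
  proof (rule Ck_on_SucI[OF assms(1), where f'="\<lambda>x v. \<Sum>i\<in>Basis. (?f' x v \<bullet> i) *\<^sub>R ?g' (f x) i"])
    fix x assume x: "x \<in> U"
    show "((\<lambda>x. g (f x)) has_derivative (\<lambda>v. \<Sum>i\<in>Basis. (?f' x v \<bullet> i) *\<^sub>R ?g' (f x) i)) (at x)"
      by (rule has_derivative_eq_rhs[OF has_derivative_compose[OF f'[OF x] g'[OF x]]])
        (rule ext, rule lin[OF x])
  next
    fix v
    show "Ck_on k (\<lambda>x. \<Sum>i\<in>Basis. (?f' x v \<bullet> i) *\<^sub>R ?g' (f x) i) U"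
    proof (rule Ck_on_sum[OF assms(1) finite_Basis])
      fix i :: 'b
      have "Ck_on k (\<lambda>x. ?g' (f x) i) U"
        using Suc.IH[OF Ck_on_Suc_imp[OF Suc.prems(1)] Ck_on_SucD(2)[OF Suc.prems(2)]] .
      moreover have "Ck_on k (\<lambda>x. ?f' x v \<bullet> i) U"
        by (rule Ck_on_bounded_bilinear[OF bounded_bilinear_inner assms(1)
              Ck_on_SucD(2)[OF Suc.prems(1)] Ck_on_const[OF assms(1)]])
      ultimately show "Ck_on k (\<lambda>x. (?f' x v \<bullet> i) *\<^sub>R ?g' (f x) i) U"
        by (intro Ck_on_bounded_bilinear[OF bounded_bilinear_scaleR assms(1)])
    qed
  qed
qed

text \<open>In each direction the derivative of \<open>cis\<close> is a fixed linear map applied to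
  \<open>cis\<close> itself, so the induction closes up.\<close>

lemma Ck_on_cis: "open U \<Longrightarrow> Ck_on k cis U"
proof (induction k)
  case 0
  then show ?case by (auto intro: continuous_intros)
next
  case (Suc k)
  have "bounded_linear (\<lambda>z. v *\<^sub>R (\<i> * z))" for v
    by (intro bounded_linear_scaleR_right bounded_linear_compose[OF bounded_linear_scaleR_right bounded_linear_mult_right])
  then have "Ck_on k (\<lambda>x. v *\<^sub>R (\<i> * cis x)) U" for v
    using Ck_on_compose[OF Suc.prems _ Suc.IH[OF Suc.prems] Ck_on_bounded_linear[OF open_UNIV]]
    by blast
  then show ?case
    by (intro Ck_on_SucI[OF Suc.prems has_derivative_cis[OF has_derivative_ident]])
qed

section \<open>Smooth maps on arbitrary subsets\<close>

lemma smooth_onI: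
  assumes "open U" "S \<subseteq> U" "\<And>k. Ck_on k f U"
  shows "smooth_on S f"
  using assms unfolding smooth_on_def by blast


lemma smooth_on_localE:
  assumes "smooth_on S f" "x \<in> S"
  obtains U F where "open U" "x \<in> U" "\<And>k. Ck_on k F U" "\<And>y. y \<in> S \<Longrightarrow> y \<in> U \<Longrightarrow> F y = f y"
proof -
  obtain U F where "open U" "x \<in> U" "\<forall>k. Ck_on k F U" "\<forall>y\<in>S \<inter> U. F y = f y"
    using assms unfolding smooth_on_def by blast
  then show thesis using that[of U F] by simp
qed

text \<open>Local extensions survive shrinking the set and changing the function off it. This
  carries smoothness from the disk to the circle and to maps cut off by \<open>restrict\<close> or
  \<open>compose\<close>.\<close>

lemma smooth_on_cong_subset:
  assumes "smooth_on T f" "S \<subseteq> T" "\<And>x. x \<in> S \<Longrightarrow> f x = g x"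
  shows "smooth_on S g"
  unfolding smooth_on_def
proof
  fix x assume "x \<in> S"
  then have "x \<in> T" using assms(2) by blast
  then obtain U F where "open U" "x \<in> U" "\<And>k. Ck_on k F U"
      "\<And>y. y \<in> T \<Longrightarrow> y \<in> U \<Longrightarrow> F y = f y"
    using smooth_on_localE[OF assms(1)] by blast
  then show "\<exists>U F. open U \<and> x \<in> U \<and> (\<forall>k. Ck_on k F U) \<and> (\<forall>y\<in>S \<inter> U. F y = g y)"
    using assms(2,3) by (intro exI[of _ U] exI[of _ F]) auto
qed

lemma smooth_on_imp_continuous_on:
  assumes "smooth_on S f" shows "continuous_on S f"
  unfolding continuous_on_def
proof
  fix x assume x: "x \<in> S"
  obtain U F where U: "open U" "x \<in> U" "\<And>k. Ck_on k F U"
      "\<And>y. y \<in> S \<Longrightarrow> y \<in> U \<Longrightarrow> F y = f y"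
    using smooth_on_localE[OF assms x] by blast
  have "isCont F x"
    using U(1,2) U(3)[of 0] by (simp add: continuous_on_eq_continuous_at)
  then have "(F \<longlongrightarrow> F x) (at x within S)"
    using continuous_at_imp_continuous_at_within continuous_within by blast
  moreover have "\<forall>\<^sub>F y in at x within S. F y = f y"
    using U unfolding eventually_at_topological by blast
  ultimately show "(f \<longlongrightarrow> f x) (at x within S)"
    using U(4)[OF x U(2)] by (simp add: tendsto_cong)
qed

text \<open>Local extensions compose on the preimage of the second domain under the first extension,
  which is open because that extension is continuous.\<close>

lemma smooth_on_compose:
  fixes f :: "'a::euclidean_space \<Rightarrow> 'b::euclidean_space" and g :: "'b \<Rightarrow> 'c::euclidean_space"
  assumes "smooth_on S f" "smooth_on T g" "f ` S \<subseteq> T"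
  shows "smooth_on S (\<lambda>x. g (f x))"
  unfolding smooth_on_def
proof
  fix x assume x: "x \<in> S"
  obtain U F where U: "open U" "x \<in> U" "\<And>k. Ck_on k F U"
      "\<And>y. y \<in> S \<Longrightarrow> y \<in> U \<Longrightarrow> F y = f y"
    using smooth_on_localE[OF assms(1) x] by blast
  have "f x \<in> T" using assms(3) x by blast
  then obtain V G where V: "open V" "f x \<in> V" "\<And>k. Ck_on k G V"
      "\<And>y. y \<in> T \<Longrightarrow> y \<in> V \<Longrightarrow> G y = g y"
    using smooth_on_localE[OF assms(2)] by blast
  have "continuous_on U F" using U(3)[of 0] by simp
  then have op: "open (F -` V \<inter> U)"
    using U(1) V(1) continuous_on_open_vimage by blast
  have "Ck_on k (\<lambda>y. G (F y)) (F -` V \<inter> U)" for k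
    by (rule Ck_on_compose[OF op _ Ck_on_subset[OF U(3)] V(3)]) auto
  moreover have "x \<in> F -` V \<inter> U" using U V x by simp
  moreover have "\<forall>y\<in>S \<inter> (F -` V \<inter> U). G (F y) = g (f y)" using U V assms(3) by auto
  ultimately show "\<exists>U H. open U \<and> x \<in> U \<and> (\<forall>k. Ck_on k H U) \<and> (\<forall>y\<in>S \<inter> U. H y = g (f y))"
    using op by (intro exI[of _ "F -` V \<inter> U"] exI[of _ "\<lambda>y. G (F y)"]) auto
qed

lemma Ck_on_local:
  assumes "\<And>x. x \<in> U \<Longrightarrow> \<exists>V. open V \<and> x \<in> V \<and> Ck_on k f V"
  shows "Ck_on k f U"
  using assms
proof (induction k arbitrary: f)
  case 0
  then show ?case
    by (metis Ck_on.simps(1) continuous_at_imp_continuous_on continuous_on_eq_continuous_at)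
next
  case (Suc k)
  then show ?case by (metis Ck_on.simps(2))
qed

text \<open>When the domain is the whole space, each local extension is the function itself near the
  point, and being of class \<open>k\<close> is a local property.\<close>

lemma smooth_on_UNIV: "smooth_on UNIV f \<longleftrightarrow> (\<forall>k. Ck_on k f UNIV)"
proof
  assume f: "smooth_on UNIV f"
  have "\<exists>V. open V \<and> x \<in> V \<and> Ck_on k f V" for k x
    using smooth_on_localE[OF f UNIV_I] Ck_on_cong by (metis UNIV_I)
  then show "\<forall>k. Ck_on k f UNIV" using Ck_on_local by blast
qed (blast intro: smooth_onI)

lemma smooth_on_UNIV_imp_differentiable: "smooth_on UNIV f \<Longrightarrow> f differentiable (at x)"
  unfolding smooth_on_UNIV by (drule spec[of _ "Suc 0"]) simp

section \<open>Derivatives on convex sets\<close>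

text \<open>At a boundary point only directions into \<open>S\<close> can be tested. Segments
  starting at \<open>z\<close> show that both derivatives agree on all \<open>y - z\<close> with
  \<open>y\<close> in \<open>S\<close>; differences of such vectors fill a neighbourhood of zero,
  and linearity does the rest.\<close>

lemma has_derivative_unique_convex:
  fixes f :: "'a::real_normed_vector \<Rightarrow> 'b::real_normed_vector"
  assumes S: "convex S" "interior S \<noteq> {}" "z \<in> S"
    and f': "(f has_derivative f') (at z within S)"
    and f'': "(f has_derivative f'') (at z within S)"
  shows "f' = f''"
proof -
  have eq: "f' (y - z) = f'' (y - z)" if "y \<in> S" for y
  proof -
    let ?\<gamma> = "\<lambda>t::real. z + t *\<^sub>R (y - z)"
    have im: "?\<gamma> ` {0..1} \<subseteq> S"
    proof
      fix w assume "w \<in> ?\<gamma> ` {0..1}"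
      then obtain t where "w = ?\<gamma> t" "0 \<le> t" "t \<le> 1" by fastforce
      then have "w = (1 - t) *\<^sub>R z + t *\<^sub>R y" by (simp add: algebra_simps)
      then show "w \<in> S"
        using convexD[OF S(1,3) that, of "1 - t" t] \<open>0 \<le> t\<close> \<open>t \<le> 1\<close> by simp
    qed
    have \<gamma>: "(?\<gamma> has_vector_derivative (y - z)) (at 0 within {0..1})"
      by (auto intro!: derivative_eq_intros)
    have "((f \<circ> ?\<gamma>) has_vector_derivative D (y - z)) (at 0 within {0..1})"
      if "(f has_derivative D) (at z within S)" for D
      using vector_derivative_diff_chain_within[OF \<gamma>, of f D] that im
      by (auto intro: has_derivative_subset)
    from this[OF f'] this[OF f''] show ?thesis
      using vector_derivative_unique_within_closed_interval[of 0 1 0] by fastforce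
  qed
  obtain c e where e: "e > 0" "ball c e \<subseteq> S"
    using S(2) by (metis all_not_in_conv mem_interior)
  have lin: "linear f'" "linear f''" using f' f'' has_derivative_linear by blast+
  \<comment> \<open>A short vector \<open>w\<close> is the difference of \<open>c + w - z\<close>
    and \<open>c - z\<close>, both of which lead from \<open>z\<close> to points of
    \<open>S\<close>.\<close>
  have small: "f' w = f'' w" if "norm w < e" for w
  proof -
    have "c + w \<in> S" "c \<in> S" using e that by (auto simp: dist_norm subset_eq)
    from eq[OF this(1)] eq[OF this(2)] show ?thesis
      using linear_diff[OF lin(1), of "c + w - z" "c - z"]
        linear_diff[OF lin(2), of "c + w - z" "c - z"] by simp
  qed
  show ?thesis
  proof
    fix w :: 'a
    \<comment> \<open>This factor scales \<open>w\<close> to norm below \<open>e\<close>; the added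
      \<open>1\<close> covers \<open>w = 0\<close>.\<close>
    define r where "r = e / 2 / (norm w + 1)"
    have n: "norm w + 1 > 0" by (smt (verit) norm_ge_zero)
    then have r: "r > 0" using e by (simp add: r_def)
    have "norm (r *\<^sub>R w) \<le> r * (norm w + 1)" using r by (simp add: algebra_simps)
    also have "\<dots> = e / 2" using n unfolding r_def by (intro nonzero_eq_divide_eq[THEN iffD1] refl) simp
    also have "\<dots> < e" using e by simp
    finally have "f' (r *\<^sub>R w) = f'' (r *\<^sub>R w)" by (rule small)
    then show "f' w = f'' w"
      using r by (simp add: linear_scale[OF lin(1)] linear_scale[OF lin(2)])
  qed
qed

lemma frechet_derivative_within_convex:
  assumes "convex S" "interior S \<noteq> {}" "z \<in> S" "(f has_derivative f') (at z within S)"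
  shows "frechet_derivative f (at z within S) = f'"
  using has_derivative_unique_convex[OF assms(1-3) _ assms(4)] assms(4)
  by (metis differentiableI frechet_derivative_works)

text \<open>Identifies the derivative within \<open>S\<close>, at boundary points too, with the
  ordinary derivative of a smooth local extension, so that results for open sets become
  available.\<close>

lemma smooth_on_local_derivative:
  assumes "smooth_on S f" "convex S" "interior S \<noteq> {}" "x \<in> S"
  obtains U F where "open U" "x \<in> U" "\<And>k. Ck_on k F U"
    "\<And>y. y \<in> S \<Longrightarrow> y \<in> U \<Longrightarrow> F y = f y"
    "\<And>y. y \<in> S \<Longrightarrow> y \<in> U \<Longrightarrow> (f has_derivative frechet_derivative F (at y)) (at y within S)"
    "\<And>y. y \<in> S \<Longrightarrow> y \<in> U \<Longrightarrow> frechet_derivative f (at y within S) = frechet_derivative F (at y)"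
proof -
  obtain U F where U: "open U" "x \<in> U" "\<And>k. Ck_on k F U"
    "\<And>y. y \<in> S \<Longrightarrow> y \<in> U \<Longrightarrow> F y = f y"
    using smooth_on_localE[OF assms(1,4)] by blast
  have der: "(f has_derivative frechet_derivative F (at y)) (at y within S)"
    if y: "y \<in> S" "y \<in> U" for y
  proof -
    have "(F has_derivative frechet_derivative F (at y)) (at y within S)"
      using Ck_on_SucD(1)[OF U(3) y(2)] has_derivative_at_withinI by blast
    moreover obtain e where "e > 0" "ball y e \<subseteq> U"
      using U(1) y(2) open_contains_ball by blast
    ultimately show ?thesis
      using y U(4) by (intro has_derivative_transform_within[of F _ y S e f]) (auto simp: dist_commute subset_eq)
  qed
  then have "frechet_derivative f (at y within S) = frechet_derivative F (at y)"
    if y: "y \<in> S" "y \<in> U" for y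
    using frechet_derivative_within_convex[OF assms(2,3)] that by blast
  with that U der show thesis by blast
qed

lemma smooth_on_has_derivative:
  assumes "smooth_on S f" "convex S" "interior S \<noteq> {}" "x \<in> S"
  shows "(f has_derivative frechet_derivative f (at x within S)) (at x within S)"
  using smooth_on_local_derivative[OF assms] assms(4) by metis

lemma smooth_on_frechet_derivative:
  assumes "smooth_on S f" "convex S" "interior S \<noteq> {}"
  shows "smooth_on S (\<lambda>x. frechet_derivative f (at x within S) v)"
  unfolding smooth_on_def
proof
  fix x assume x: "x \<in> S"
  obtain U F where U: "open U" "x \<in> U" "\<And>k. Ck_on k F U"
    "\<And>y. y \<in> S \<Longrightarrow> y \<in> U \<Longrightarrow> frechet_derivative f (at y within S) = frechet_derivative F (at y)"
    using smooth_on_local_derivative[OF assms x] by metis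
  have "Ck_on k (\<lambda>y. frechet_derivative F (at y) v) U" for k
    using Ck_on_SucD(2)[OF U(3)] .
  then show "\<exists>U G. open U \<and> x \<in> U \<and> (\<forall>k. Ck_on k G U) \<and>
      (\<forall>y\<in>S \<inter> U. G y = frechet_derivative f (at y within S) v)"
    using U by (intro exI[of _ U] exI[of _ "\<lambda>y. frechet_derivative F (at y) v"]) auto
qed

text \<open>The second difference is symmetric in \<open>u\<close> and \<open>v\<close>, which yields the symmetry of the second
  derivative in the limit \<open>s \<rightarrow> 0\<close>.\<close>

lemma second_difference_mean_value:
  fixes f :: "'a::real_normed_vector \<Rightarrow> real"
  assumes U: "ball x e \<subseteq> U" and s: "s > 0" "s * (norm u + norm v) < e"
    and f': "\<And>y. y \<in> U \<Longrightarrow> (f has_derivative f' y) (at y)"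
    and f'': "\<And>y. y \<in> U \<Longrightarrow> ((\<lambda>y. f' y u) has_derivative f'' y) (at y)"
  obtains y where "y \<in> ball x e"
    "f (x + s *\<^sub>R u + s *\<^sub>R v) - f (x + s *\<^sub>R u) - f (x + s *\<^sub>R v) + f x = s\<^sup>2 * f'' y v"
proof -
  have near: "x + p *\<^sub>R u + q *\<^sub>R v \<in> ball x e" if "0 \<le> p" "p \<le> s" "0 \<le> q" "q \<le> s" for p q
  proof -
    have "norm (p *\<^sub>R u + q *\<^sub>R v) \<le> p * norm u + q * norm v"
      using norm_triangle_ineq[of "p *\<^sub>R u" "q *\<^sub>R v"] that by simp
    also have "\<dots> \<le> s * norm u + s * norm v"
      using that by (intro add_mono mult_right_mono) auto
    also have "\<dots> < e" using s by (simp add: algebra_simps)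
    finally show ?thesis
      using norm_minus_cancel[of "p *\<^sub>R u + q *\<^sub>R v"] by (simp add: dist_norm)
  qed
  have der: "((\<lambda>p. f (x + p *\<^sub>R u + q *\<^sub>R v)) has_real_derivative f' (x + p *\<^sub>R u + q *\<^sub>R v) u) (at p)"
    if "0 \<le> p" "p \<le> s" "0 \<le> q" "q \<le> s" for p q
  proof -
    have "x + p *\<^sub>R u + q *\<^sub>R v \<in> U" using near[OF that] U by blast
    note d1 = f'[OF this]
    have d2: "((\<lambda>p. x + p *\<^sub>R u + q *\<^sub>R v) has_derivative (\<lambda>h. h *\<^sub>R u)) (at p)"
      by (auto intro!: derivative_eq_intros)
    have "((\<lambda>p. f (x + p *\<^sub>R u + q *\<^sub>R v)) has_derivative
        (\<lambda>h. f' (x + p *\<^sub>R u + q *\<^sub>R v) (h *\<^sub>R u))) (at p)"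
      by (rule has_derivative_compose[OF d2 d1])
    moreover have "f' (x + p *\<^sub>R u + q *\<^sub>R v) (h *\<^sub>R u) = f' (x + p *\<^sub>R u + q *\<^sub>R v) u * h" for h
      using linear_scale[OF has_derivative_linear[OF f'[OF \<open>x + p *\<^sub>R u + q *\<^sub>R v \<in> U\<close>]]] by simp
    ultimately show ?thesis by (simp add: has_field_derivative_def)
  qed
  \<comment> \<open>Mean value theorem in \<open>p\<close> for the difference of \<open>f\<close>
    along the lines \<open>q = s\<close> and \<open>q = 0\<close>. The zero multiples are kept so
    that \<open>der\<close> matches.\<close>
  have "\<exists>p>0. p < s \<and>
      (f (x + s *\<^sub>R u + s *\<^sub>R v) - f (x + s *\<^sub>R u + 0 *\<^sub>R v)) -
      (f (x + 0 *\<^sub>R u + s *\<^sub>R v) - f (x + 0 *\<^sub>R u + 0 *\<^sub>R v))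
      = (s - 0) * (f' (x + p *\<^sub>R u + s *\<^sub>R v) u - f' (x + p *\<^sub>R u + 0 *\<^sub>R v) u)"
    by (rule MVT2[OF s(1)]) (use s in \<open>auto intro!: DERIV_diff der simp del: scaleR_zero_left\<close>)
  then obtain p where p: "0 < p" "p < s"
    "f (x + s *\<^sub>R u + s *\<^sub>R v) - f (x + s *\<^sub>R u) - f (x + s *\<^sub>R v) + f x
      = s * (f' (x + p *\<^sub>R u + s *\<^sub>R v) u - f' (x + p *\<^sub>R u) u)"
    by auto
  have der2: "((\<lambda>q. f' (x + p *\<^sub>R u + q *\<^sub>R v) u) has_real_derivative f'' (x + p *\<^sub>R u + q *\<^sub>R v) v) (at q)"
    if "0 \<le> q" "q \<le> s" for q
  proof -
    have "x + p *\<^sub>R u + q *\<^sub>R v \<in> U" using near[of p q] that p U by auto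
    note d1 = f''[OF this]
    have d2: "((\<lambda>q. x + p *\<^sub>R u + q *\<^sub>R v) has_derivative (\<lambda>h. h *\<^sub>R v)) (at q)"
      by (auto intro!: derivative_eq_intros)
    have "((\<lambda>q. f' (x + p *\<^sub>R u + q *\<^sub>R v) u) has_derivative
        (\<lambda>h. f'' (x + p *\<^sub>R u + q *\<^sub>R v) (h *\<^sub>R v))) (at q)"
      by (rule has_derivative_compose[OF d2 d1])
    moreover have "f'' (x + p *\<^sub>R u + q *\<^sub>R v) (h *\<^sub>R v) = f'' (x + p *\<^sub>R u + q *\<^sub>R v) v * h" for h
      using linear_scale[OF has_derivative_linear[OF f''[OF \<open>x + p *\<^sub>R u + q *\<^sub>R v \<in> U\<close>]]] by simp
    ultimately show ?thesis by (simp add: has_field_derivative_def)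
  qed
  \<comment> \<open>Second mean value theorem, now in \<open>q\<close> with the intermediate
    \<open>p\<close> held fixed.\<close>
  have "\<exists>q>0. q < s \<and> f' (x + p *\<^sub>R u + s *\<^sub>R v) u - f' (x + p *\<^sub>R u + 0 *\<^sub>R v) u
      = (s - 0) * f'' (x + p *\<^sub>R u + q *\<^sub>R v) v"
    by (rule MVT2[OF s(1)]) (use der2 in auto)
  then obtain q where "0 < q" "q < s"
    "f' (x + p *\<^sub>R u + s *\<^sub>R v) u - f' (x + p *\<^sub>R u) u = s * f'' (x + p *\<^sub>R u + q *\<^sub>R v) v"
    by auto
  with p near[of p q] show thesis
    by (intro that[of "x + p *\<^sub>R u + q *\<^sub>R v"]) (auto simp: power2_eq_square)
qed

lemma symmetric_second_derivative_real:
  fixes f :: "'a::real_normed_vector \<Rightarrow> real"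
  assumes U: "open U" "x \<in> U"
    and f': "\<And>y. y \<in> U \<Longrightarrow> (f has_derivative f' y) (at y)"
    and f'': "\<And>y u. y \<in> U \<Longrightarrow> ((\<lambda>y. f' y u) has_derivative f'' y u) (at y)"
    and cont: "\<And>u v. continuous_on U (\<lambda>y. f'' y u v)"
  shows "f'' x u v = f'' x v u"
proof (rule ccontr)
  assume neq: "f'' x u v \<noteq> f'' x v u"
  \<comment> \<open>Half the gap: near \<open>x\<close> each mixed derivative stays within
    \<open>r\<close> of its value at \<open>x\<close>, so the two cannot take a common value there,
    while the symmetric second difference forces them to.\<close>
  define r where "r = \<bar>f'' x u v - f'' x v u\<bar> / 2"
  have "r > 0" using neq by (simp add: r_def)
  have near: "\<forall>\<^sub>F y in nhds x. y \<in> U \<and> \<bar>f'' y a b - f'' x a b\<bar> < r" for a b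
  proof -
    have "isCont (\<lambda>y. f'' y a b) x"
      using cont U by (simp add: continuous_on_eq_continuous_at)
    then have "\<forall>\<^sub>F y in nhds x. dist (f'' y a b) (f'' x a b) < r"
      using \<open>r > 0\<close> tendstoD tendsto_at_iff_tendsto_nhds isCont_def by blast
    then show ?thesis
      using eventually_nhds_in_open[OF U] by eventually_elim (auto simp: dist_real_def)
  qed
  obtain e where e: "e > 0" "\<And>y. y \<in> ball x e \<Longrightarrow> y \<in> U \<and> \<bar>f'' y u v - f'' x u v\<bar> < r \<and> \<bar>f'' y v u - f'' x v u\<bar> < r"
    using eventually_conj[OF near[of u v] near[of v u]]
    unfolding eventually_nhds_metric by (auto simp: dist_commute)
  define s where "s = e / 2 / (norm u + norm v + 1)"
  have n: "norm u + norm v + 1 > 0" by (smt (verit) norm_ge_zero)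
  then have s: "s > 0" using e by (simp add: s_def)
  have "s * (norm u + norm v) \<le> s * (norm u + norm v + 1)" using s by simp
  also have "\<dots> = e / 2" using n unfolding s_def by (intro nonzero_eq_divide_eq[THEN iffD1] refl) simp
  also have "\<dots> < e" using e by simp
  finally have s2: "s * (norm u + norm v) < e" .
  have sub: "ball x e \<subseteq> U" using e by blast
  obtain y where y: "y \<in> ball x e"
    "f (x + s *\<^sub>R u + s *\<^sub>R v) - f (x + s *\<^sub>R u) - f (x + s *\<^sub>R v) + f x = s\<^sup>2 * f'' y u v"
    using second_difference_mean_value[OF sub s s2 f' f''] by blast
  obtain z where z: "z \<in> ball x e"
    "f (x + s *\<^sub>R v + s *\<^sub>R u) - f (x + s *\<^sub>R v) - f (x + s *\<^sub>R u) + f x = s\<^sup>2 * f'' z v u"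
    using second_difference_mean_value[OF sub s, of v u f f' "\<lambda>y. f'' y v"] s2 f' f''
    by (metis add.commute)
  have "s\<^sup>2 * f'' y u v = s\<^sup>2 * f'' z v u"
    using y(2) z(2) by (simp add: algebra_simps)
  then have "f'' y u v = f'' z v u" using s by simp
  with e(2)[OF y(1)] e(2)[OF z(1)] show False
    unfolding r_def by (smt (verit) field_sum_of_halves)
qed

text \<open>Near \<open>x\<close> all derivatives within \<open>S\<close> are those of one local
  extension, so the symmetry on open sets applies to it, one coordinate at a time.\<close>

lemma smooth_on_symmetric_second_derivative:
  fixes f :: "'a::euclidean_space \<Rightarrow> 'b::euclidean_space"
  assumes "smooth_on S f" "convex S" "interior S \<noteq> {}" "x \<in> S"
  defines "f' \<equiv> \<lambda>y. frechet_derivative f (at y within S)"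
  shows "frechet_derivative (\<lambda>y. f' y u) (at x within S) v =
    frechet_derivative (\<lambda>y. f' y v) (at x within S) u"
proof -
  obtain U F where U: "open U" "x \<in> U" "\<And>k. Ck_on k F U"
    "\<And>y. y \<in> S \<Longrightarrow> y \<in> U \<Longrightarrow> f' y = frechet_derivative F (at y)"
    unfolding f'_def using smooth_on_local_derivative[OF assms(1-4)] by metis
  let ?F' = "\<lambda>y. frechet_derivative F (at y)"
  let ?F'' = "\<lambda>y u. frechet_derivative (\<lambda>y. ?F' y u) (at y)"
  have F': "(F has_derivative ?F' y) (at y)" if "y \<in> U" for y
    using Ck_on_SucD(1)[OF U(3) that] .
  have F'': "((\<lambda>y. ?F' y u) has_derivative ?F'' y u) (at y)" if "y \<in> U" for y u
    using Ck_on_SucD(1)[OF Ck_on_SucD(2)[OF U(3)] that] .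
  have cont: "continuous_on U (\<lambda>y. ?F'' y u v)" for u v
    using Ck_on_SucD(2)[OF Ck_on_SucD(2)[OF U(3)], of 0] by simp
  have sym: "?F'' x u v = ?F'' x v u" for u v
  proof (rule euclidean_eqI)
    fix b :: 'b
    show "?F'' x u v \<bullet> b = ?F'' x v u \<bullet> b"
      by (rule symmetric_second_derivative_real[OF U(1,2), of "\<lambda>y. F y \<bullet> b" "\<lambda>y v. ?F' y v \<bullet> b"
            "\<lambda>y u v. ?F'' y u v \<bullet> b"])
        (auto intro!: has_derivative_inner_left F' F'' continuous_intros cont)
  qed
  have eq: "frechet_derivative (\<lambda>y. f' y u) (at x within S) = ?F'' x u" for u
  proof (rule frechet_derivative_within_convex[OF assms(2-4)])
    obtain e where "e > 0" "ball x e \<subseteq> U"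
      using U open_contains_ball by blast
    then show "((\<lambda>y. f' y u) has_derivative ?F'' x u) (at x within S)"
      using U assms(4)
      by (intro has_derivative_transform_within[OF has_derivative_at_withinI[OF F''[OF U(2)]], of e])
        (auto simp: dist_commute subset_eq)
  qed
  show ?thesis using sym by (simp add: eq)
qed


section \<open>Primitives of closed one-forms\<close>

text \<open>Poincare lemma up to the boundary. Since \<open>\<theta>' z v\<close> is the derivative
  of \<open>\<theta>\<close> with the vector \<open>v\<close> frozen, its symmetry is closedness.
  Differentiating the ray integral \<open>P\<close> under the integral sign gives an integrand which
  closedness turns into the \<open>t\<close>-derivative of
  \<open>t * \<theta> (t *\<^sub>R z) v\<close>.\<close>

lemma closed_one_form_has_primitive:
  fixes \<theta> :: "'a::euclidean_space \<Rightarrow> 'a \<Rightarrow> real"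
  assumes S: "convex S" "0 \<in> S"
    and lin: "\<And>z. z \<in> S \<Longrightarrow> linear (\<theta> z)"
    and der: "\<And>z v. z \<in> S \<Longrightarrow> ((\<lambda>z. \<theta> z v) has_derivative \<theta>' z v) (at z within S)"
    and closed: "\<And>z u v. z \<in> S \<Longrightarrow> \<theta>' z u v = \<theta>' z v u"
    and cont: "\<And>u v. continuous_on S (\<lambda>z. \<theta>' z u v)"
  obtains P where "\<And>z. z \<in> S \<Longrightarrow> (P has_derivative \<theta> z) (at z within S)"
proof
  define P where "P = (\<lambda>z. integral (cbox 0 1) (\<lambda>t. \<theta> (t *\<^sub>R z) z))"
  \<comment> \<open>\<open>D z t\<close> is the derivative in \<open>z\<close> of
    \<open>\<theta> (t *\<^sub>R z) z\<close>, where \<open>z\<close> moves both the base point and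
    the vector.\<close>
  define D where "D = (\<lambda>z t v. \<theta>' (t *\<^sub>R z) z (t *\<^sub>R v) + \<theta> (t *\<^sub>R z) v)"
  have tS: "t *\<^sub>R z \<in> S" if "z \<in> S" "t \<in> cbox 0 1" for z and t :: real
    using convexD[OF S(1) that(1) S(2), of t "1 - t"] that(2) by simp
  have lin': "linear (\<theta>' z v)" if "z \<in> S" for z v
    using der[OF that] has_derivative_linear by blast
  have lin'': "linear (\<lambda>v. \<theta>' z v u)" if "z \<in> S" for z u
  proof -
    have "(\<lambda>v. \<theta>' z v u) = \<theta>' z u" using closed[OF that] by blast
    then show ?thesis using lin'[OF that] by simp
  qed
  have expand: "\<theta> z v = (\<Sum>i\<in>Basis. (v \<bullet> i) * \<theta> z i)" if "z \<in> S" for z v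
  proof -
    have "\<theta> z v = \<theta> z (\<Sum>i\<in>Basis. (v \<bullet> i) *\<^sub>R i)" by (simp add: euclidean_representation)
    then show ?thesis by (simp add: linear_sum[OF lin[OF that]] linear_scale[OF lin[OF that]])
  qed
  have expand': "\<theta>' z v u = (\<Sum>i\<in>Basis. (v \<bullet> i) * \<theta>' z i u)" if "z \<in> S" for z u v
  proof -
    have "\<theta>' z v u = \<theta>' z (\<Sum>i\<in>Basis. (v \<bullet> i) *\<^sub>R i) u" by (simp add: euclidean_representation)
    also have "\<dots> = (\<Sum>i\<in>Basis. (v \<bullet> i) * \<theta>' z i u)"
      using linear_sum[OF lin''[OF that, of u], of "\<lambda>i. (v \<bullet> i) *\<^sub>R i" Basis]
        linear_scale[OF lin''[OF that, of u]] by simp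
    finally show ?thesis .
  qed
  have c\<theta>: "continuous_on S (\<lambda>z. \<theta> z v)" for v
    using der has_derivative_continuous continuous_on_eq_continuous_within by blast
  \<comment> \<open>Coordinates separate the moving vector from the moving base point, so that
    \<open>der\<close>, which holds for fixed vectors, applies to each term.\<close>
  have D: "((\<lambda>z. \<theta> (t *\<^sub>R z) z) has_derivative D z t) (at z within S)"
    if z: "z \<in> S" and t: "t \<in> cbox 0 1" for z t
  proof -
    have sc: "((\<lambda>z. t *\<^sub>R z) has_derivative (\<lambda>v. t *\<^sub>R v)) (at z within S)"
      by (auto intro!: derivative_eq_intros)
    have "((\<lambda>z. \<theta> (t *\<^sub>R z) i) has_derivative (\<lambda>v. \<theta>' (t *\<^sub>R z) i (t *\<^sub>R v))) (at z within S)" for i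
      using has_derivative_in_compose2[OF der _ z sc, of i] tS t by auto
    then have "((\<lambda>z. \<Sum>i\<in>Basis. (z \<bullet> i) * \<theta> (t *\<^sub>R z) i) has_derivative
        (\<lambda>v. \<Sum>i\<in>Basis. (z \<bullet> i) * \<theta>' (t *\<^sub>R z) i (t *\<^sub>R v) + (v \<bullet> i) * \<theta> (t *\<^sub>R z) i)) (at z within S)"
      by (auto intro!: derivative_intros)
    moreover have "D z t = (\<lambda>v. \<Sum>i\<in>Basis. (z \<bullet> i) * \<theta>' (t *\<^sub>R z) i (t *\<^sub>R v) + (v \<bullet> i) * \<theta> (t *\<^sub>R z) i)"
      unfolding D_def sum.distrib by (intro ext arg_cong2[where f="(+)"] expand expand' tS that)
    ultimately have "((\<lambda>z. \<Sum>i\<in>Basis. (z \<bullet> i) * \<theta> (t *\<^sub>R z) i) has_derivative D z t) (at z within S)"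
      by (simp only:)
    then show ?thesis
      by (rule has_derivative_transform[OF z, rotated]) (rule expand[OF tS[OF _ t]])
  qed
  have bl: "bounded_linear (D z t)" if "z \<in> S" "t \<in> cbox 0 1" for z t
    using D[OF that] has_derivative_bounded_linear by blast
  have contD: "continuous_on (S \<times> cbox 0 1) (\<lambda>(z, t). D z t v)" for v
  proof -
    have "continuous_on (S \<times> cbox 0 1) (\<lambda>p. \<theta>' (snd p *\<^sub>R fst p) i v)" for i
      by (rule continuous_on_compose2[OF cont]) (auto intro!: continuous_intros tS)
    moreover have "continuous_on (S \<times> cbox 0 1) (\<lambda>p. \<theta> (snd p *\<^sub>R fst p) v)"
      by (rule continuous_on_compose2[OF c\<theta>]) (auto intro!: continuous_intros tS)
    ultimately have "continuous_on (S \<times> cbox 0 1)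
        (\<lambda>p. (\<Sum>i\<in>Basis. (fst p \<bullet> i) * (snd p * \<theta>' (snd p *\<^sub>R fst p) i v)) + \<theta> (snd p *\<^sub>R fst p) v)"
      by (intro continuous_intros)
    moreover have "D (fst p) (snd p) v =
        (\<Sum>i\<in>Basis. (fst p \<bullet> i) * (snd p * \<theta>' (snd p *\<^sub>R fst p) i v)) + \<theta> (snd p *\<^sub>R fst p) v"
      if "p \<in> S \<times> cbox 0 1" for p
    proof -
      have "snd p *\<^sub>R fst p \<in> S" using that tS by auto
      then show ?thesis
        unfolding D_def by (subst expand') (auto simp: linear_scale[OF lin'])
    qed
    ultimately show ?thesis by (simp add: case_prod_beta cong: continuous_on_cong)
  qed
  fix z assume z: "z \<in> S"
  \<comment> \<open>The Leibniz rule asks for a derivative that is continuous as a bounded operator;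
    in finite dimension it suffices to check its values on the basis.\<close>
  have contB: "continuous_on (S \<times> cbox 0 1) (\<lambda>(z, t). Blinfun (D z t))"
  proof -
    have "continuous_on (S \<times> cbox 0 1) (\<lambda>p. blinfun_apply (Blinfun (D (fst p) (snd p))) i)" for i
      by (rule continuous_on_eq[OF contD[of i, unfolded case_prod_beta]])
        (auto simp: bounded_linear_Blinfun_apply bl)
    then show ?thesis
      by (simp add: case_prod_beta continuous_on_blinfun_componentwise)
  qed
  have "(P has_derivative blinfun_apply (integral (cbox 0 1) (\<lambda>t. Blinfun (D z t)))) (at z within S)"
    unfolding P_def
  proof (rule leibniz_rule[OF _ _ contB z S(1)])
    fix z and t :: real assume zt: "z \<in> S" "t \<in> cbox 0 1"
    show "((\<lambda>z. \<theta> (t *\<^sub>R z) z) has_derivative blinfun_apply (Blinfun (D z t))) (at z within S)"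
      using D[OF zt] bl[OF zt] by (simp add: bounded_linear_Blinfun_apply)
  next
    fix z assume "z \<in> S"
    then show "(\<lambda>t. \<theta> (t *\<^sub>R z) z) integrable_on cbox 0 1"
      by (intro integrable_continuous continuous_on_compose2[OF c\<theta>] tS continuous_intros) (auto intro: tS)
  qed
  moreover have "blinfun_apply (integral (cbox 0 1) (\<lambda>t. Blinfun (D z t))) v = \<theta> z v" for v
  proof -
    have "continuous_on (cbox (0::real) 1) (\<lambda>t. (z, t))" by (intro continuous_intros)
    from continuous_on_compose2[OF contB this] z
    have "continuous_on (cbox 0 1) (\<lambda>t. Blinfun (D z t))" by auto
    then have "blinfun_apply (integral (cbox 0 1) (\<lambda>t. Blinfun (D z t))) v =
        integral (cbox 0 1) (\<lambda>t. blinfun_apply (Blinfun (D z t)) v)"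
      by (intro blinfun_apply_integral integrable_continuous)
    also have "\<dots> = integral (cbox 0 1) (\<lambda>t. D z t v)"
      by (intro integral_cong) (simp add: bounded_linear_Blinfun_apply bl z)
    also have "\<dots> = 1 * \<theta> (1 *\<^sub>R z) v - 0 * \<theta> (0 *\<^sub>R z) v"
      unfolding cbox_interval
    proof (intro integral_unique fundamental_theorem_of_calculus)
      fix t :: real assume t: "t \<in> {0..1}"
      then have tz: "t *\<^sub>R z \<in> S" using tS z by simp
      have sc: "((\<lambda>t. t *\<^sub>R z) has_derivative (\<lambda>s. s *\<^sub>R z)) (at t within {0..1})"
        by (auto intro!: derivative_eq_intros)
      have "(\<lambda>t. t *\<^sub>R z) ` {0..1} \<subseteq> S" using tS z by auto
      from has_derivative_in_compose2[OF der this t sc]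
      have "((\<lambda>t. \<theta> (t *\<^sub>R z) v) has_derivative (\<lambda>s. \<theta>' (t *\<^sub>R z) v (s *\<^sub>R z))) (at t within {0..1})" .
      then have "((\<lambda>t. t * \<theta> (t *\<^sub>R z) v) has_derivative
          (\<lambda>s. t * \<theta>' (t *\<^sub>R z) v (s *\<^sub>R z) + s * \<theta> (t *\<^sub>R z) v)) (at t within {0..1})"
        by (auto intro!: derivative_eq_intros)
      \<comment> \<open>Closedness swaps \<open>v\<close> and \<open>z\<close> here and so matches
        the derivative along the ray with \<open>D z t v\<close>.\<close>
      moreover have "t * \<theta>' (t *\<^sub>R z) v (s *\<^sub>R z) + s * \<theta> (t *\<^sub>R z) v = s *\<^sub>R D z t v" for s
        using closed[OF tz, of z v] linear_scale[OF lin'[OF tz]] linear_scale[OF lin''[OF tz]]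
        by (simp add: D_def algebra_simps)
      ultimately show "((\<lambda>t. t * \<theta> (t *\<^sub>R z) v) has_vector_derivative D z t v) (at t within {0..1})"
        by (simp add: has_vector_derivative_def)
    qed simp
    finally show ?thesis by simp
  qed
  ultimately show "(P has_derivative \<theta> z) (at z within S)"
    by (metis (no_types, lifting) has_derivative_eq_rhs ext)
qed

text \<open>Fundamental theorem of calculus along the path. As \<open>\<gamma>\<close> is only
  piecewise continuously differentiable, a finite set of times is excepted; at the other interior
  times the derivative within \<open>{0..1}\<close> is the full one.\<close>

lemma has_line_integral_primitive:
  assumes P: "\<And>z. z \<in> S \<Longrightarrow> (P has_derivative \<alpha> z) (at z within S)"
    and \<gamma>: "valid_path \<gamma>" "path_image \<gamma> \<subseteq> S"
  shows "has_line_integral \<alpha> (P (pathfinish \<gamma>) - P (pathstart \<gamma>)) \<gamma>"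
proof -
  obtain K where c\<gamma>: "continuous_on {0..1} \<gamma>" and K: "finite K" "\<gamma> C1_differentiable_on ({0..1} - K)"
    using \<gamma>(1) unfolding valid_path_def piecewise_C1_differentiable_on_def by blast
  have \<gamma>S: "\<gamma> ` {0..1} \<subseteq> S" using \<gamma>(2) by (simp add: path_image_def)
  have "((\<lambda>t. \<alpha> (\<gamma> t) (vector_derivative \<gamma> (at t within {0..1}))) has_integral
      (P \<circ> \<gamma>) 1 - (P \<circ> \<gamma>) 0) {0..1}"
  proof (rule fundamental_theorem_of_calculus_interior_strong[OF K(1)])
    have "continuous_on S P"
      using P has_derivative_continuous continuous_on_eq_continuous_within by blast
    then show "continuous_on {0..1} (P \<circ> \<gamma>)"
      using continuous_on_subset[OF _ \<gamma>S] by (intro continuous_on_compose c\<gamma>)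
  next
    fix t assume t: "t \<in> {0<..<1} - K"
    let ?v = "vector_derivative \<gamma> (at t within {0..1})"
    obtain w where "(\<gamma> has_vector_derivative w) (at t)"
      using K(2) t unfolding C1_differentiable_on_def
      by (meson DiffD1 DiffD2 DiffI atLeastAtMost_iff greaterThanLessThan_iff less_imp_le)
    then have "(\<gamma> has_vector_derivative ?v) (at t within {0..1})"
      using differentiableI_vector has_vector_derivative_at_within vector_derivative_works by blast
    moreover have "(P has_derivative \<alpha> (\<gamma> t)) (at (\<gamma> t) within \<gamma> ` {0..1})"
      using t \<gamma>S by (intro has_derivative_subset[OF P \<gamma>S]) auto
    ultimately have "(P \<circ> \<gamma> has_vector_derivative \<alpha> (\<gamma> t) ?v) (at t within {0..1})"
      by (rule vector_derivative_diff_chain_within)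
    then show "(P \<circ> \<gamma> has_vector_derivative \<alpha> (\<gamma> t) ?v) (at t)"
      using t at_within_interior[of t "{0..1}"] by simp
  qed simp
  then show ?thesis
    by (simp add: has_line_integral_def pathstart_def pathfinish_def)
qed

section \<open>Lifts of circle-valued functions\<close>

lemma cis_eq_cis_iff: "cis a = cis b \<longleftrightarrow> (\<exists>n::int. a = b + 2 * pi * of_int n)"
  using sin_cos_eq_iff[of a b] by (auto simp: complex_eq_iff)

lemma cis_Arg_unit: "norm z = 1 \<Longrightarrow> cis (Arg z) = z"
  using cis_Arg[of z] by (cases "z = 0") (auto simp: sgn_eq)

text \<open>The difference divided by \<open>2 * pi\<close> is continuous and integer-valued, hence
  constant on the connected line.\<close>

lemma cis_lift_unique:
  fixes \<phi> \<psi> :: "real \<Rightarrow> real"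
  assumes "continuous_on UNIV \<phi>" "continuous_on UNIV \<psi>" "\<And>x. cis (\<phi> x) = cis (\<psi> x)"
  obtains n :: int where "\<And>x. \<phi> x = \<psi> x + 2 * pi * of_int n"
proof -
  let ?f = "\<lambda>x. (\<phi> x - \<psi> x) / (2 * pi)"
  have int: "\<exists>n::int. ?f x = of_int n" for x
    using assms(3)[of x] by (auto simp: cis_eq_cis_iff)
  have "?f constant_on UNIV"
  proof (rule continuous_discrete_range_constant)
    show "continuous_on UNIV ?f" using assms by (auto intro!: continuous_intros)
    fix x :: real
    have "1 \<le> norm (?f y - ?f x)" if "?f y \<noteq> ?f x" for y
    proof -
      obtain m n :: int where mn: "?f y = of_int m" "?f x = of_int n" using int by metis
      then show ?thesis using that by (simp add: mn flip: of_int_diff)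
    qed
    then show "\<exists>e>0. \<forall>y. y \<in> UNIV \<and> ?f y \<noteq> ?f x \<longrightarrow> e \<le> norm (?f y - ?f x)"
      by (intro exI[of _ 1]) auto
  qed auto
  then obtain c where c: "\<And>x. ?f x = c" by (auto simp: constant_on_def)
  obtain n :: int where "c = of_int n" using int c by metis
  then have "\<phi> x = \<psi> x + 2 * pi * of_int n" for x
    using c[of x] by (simp add: field_simps)
  then show thesis by (rule that)
qed

text \<open>The angle is found by integrating the angular velocity
  \<open>Im (cnj (m x) * m' x)\<close>, which makes it smooth along with \<open>m\<close>.\<close>

lemma cis_lift_exists:
  fixes m :: "real \<Rightarrow> complex"
  assumes smooth: "smooth_on UNIV m" and norm: "\<And>x. norm (m x) = 1"
  obtains \<phi> where "smooth_on UNIV \<phi>" "\<And>x. cis (\<phi> x) = m x"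
proof -
  have Ck: "Ck_on k m UNIV" for k using smooth by (simp add: smooth_on_UNIV)
  define m' where "m' = (\<lambda>x. frechet_derivative m (at x) 1)"
  define a where "a = (\<lambda>x. Im (cnj (m x) * m' x))"
  have m': "(m has_vector_derivative m' x) (at x)" for x
  proof -
    have "m differentiable (at x)" by (rule smooth_on_UNIV_imp_differentiable[OF smooth])
    moreover from this have "m' x = vector_derivative m (at x)"
      by (simp add: m'_def frechet_derivative_eq_vector_derivative)
    ultimately show ?thesis by (simp add: vector_derivative_works)
  qed
  have "Ck_on k m' UNIV" for k
    unfolding m'_def using Ck_on_SucD(2)[OF Ck] .
  moreover have "Ck_on k (\<lambda>x. cnj (m x)) UNIV" for k
    by (rule Ck_on_compose[OF open_UNIV _ Ck Ck_on_bounded_linear[OF open_UNIV bounded_linear_cnj]]) simp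
  ultimately have prod: "Ck_on k (\<lambda>x. cnj (m x) * m' x) UNIV" for k
    by (intro Ck_on_bounded_bilinear[OF bounded_bilinear_mult open_UNIV])
  have Ck_a: "Ck_on k a UNIV" for k
    unfolding a_def
    by (rule Ck_on_compose[OF open_UNIV _ prod Ck_on_bounded_linear[OF open_UNIV bounded_linear_Im]]) simp
  then have "isCont a x" for x
    using Ck_on_imp_continuous_on continuous_on_eq_continuous_at by blast
  then obtain F where F: "\<And>x. (F has_vector_derivative a x) (at x)"
    using einterval_antiderivative[of "-\<infinity>" "\<infinity>" a] by auto
  define \<phi> where "\<phi> = (\<lambda>x. F x - F 0 + Arg (m 0))"
  have \<phi>': "(\<phi> has_vector_derivative a x) (at x)" for x
    unfolding \<phi>_def by (auto intro!: derivative_eq_intros F)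
  \<comment> \<open>Differentiating \<open>m x \<bullet> m x = 1\<close> shows that the velocity is
    orthogonal to \<open>m x\<close>, so \<open>cnj (m x) * m' x\<close> is purely
    imaginary.\<close>
  have ode: "m' x = \<i> * of_real (a x) * m x" for x
  proof -
    have "((\<lambda>x. m x \<bullet> m x) has_vector_derivative (m x \<bullet> m' x + m' x \<bullet> m x)) (at x)"
      using bounded_bilinear.has_vector_derivative[OF bounded_bilinear_inner m' m'] .
    moreover have "(\<lambda>x. m x \<bullet> m x) = (\<lambda>x. 1)"
      using norm by (simp add: norm_eq_1)
    ultimately have "m x \<bullet> m' x = 0"
      using vector_derivative_unique_at[of "\<lambda>x. 1::real" "m x \<bullet> m' x + m' x \<bullet> m x" x 0]
      by (simp add: inner_commute)
    then have "cnj (m x) * m' x = \<i> * of_real (a x)"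
      by (simp add: a_def complex_eq_iff inner_complex_def)
    then have "m x * cnj (m x) * m' x = \<i> * of_real (a x) * m x"
      by (simp add: algebra_simps)
    then show ?thesis using norm[of x] by (simp add: complex_norm_square[symmetric])
  qed
  \<comment> \<open>The differential equation makes this quotient constant; the initial angle
    \<open>Arg (m 0)\<close> then gives it the value \<open>1\<close>.\<close>
  have "((\<lambda>x. m x * cis (- \<phi> x)) has_vector_derivative 0) (at x)" for x
  proof -
    have "((\<lambda>x. cis (- \<phi> x)) has_vector_derivative (- a x) *\<^sub>R (\<i> * cis (- \<phi> x))) (at x)"
      using \<phi>' unfolding has_vector_derivative_def by (auto intro!: derivative_eq_intros)
    from has_vector_derivative_mult[OF m' this] show ?thesis
      by (simp add: ode scaleR_conv_of_real algebra_simps)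
  qed
  then obtain c where c: "\<And>x. m x * cis (- \<phi> x) = c"
    using has_vector_derivative_zero_constant[of UNIV "\<lambda>x. m x * cis (- \<phi> x)"] by auto
  have "m 0 = cis (Arg (m 0))"
    using cis_Arg_unit[OF norm] by simp
  then have "c = 1" using c[of 0] by (metis \<phi>_def add_0 cis_mult cis_zero diff_self right_minus)
  have "cis (\<phi> x) = m x" for x
    using c[of x] \<open>c = 1\<close> by (metis cis_cnj cis_inverse cis_neq_zero inverse_unique mult.commute inverse_inverse_eq)
  moreover have "smooth_on UNIV \<phi>"
    unfolding smooth_on_UNIV
  proof
    fix k
    have "Ck_on k (\<lambda>x. v *\<^sub>R a x) UNIV" for v
      by (intro Ck_on_bounded_bilinear[OF bounded_bilinear_scaleR] Ck_on_const Ck_a open_UNIV)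
    then have "Ck_on (Suc k) \<phi> UNIV"
      using \<phi>' unfolding has_vector_derivative_def by (intro Ck_on_SucI) auto
    then show "Ck_on k \<phi> UNIV" by (rule Ck_on_Suc_imp)
  qed
  ultimately show thesis by (rule that[rotated])
qed

lemma quasi_periodic_of_int:
  fixes f :: "real \<Rightarrow> real"
  assumes "\<And>x. f (x + p) = f x + c"
  shows "f (x + p * of_int n) = f x + c * of_int n"
proof (induction n rule: int_induct[of _ 0])
  case (step1 n)
  then show ?case using assms[of "x + p * of_int n"] by (simp add: algebra_simps)
next
  case (step2 n)
  then show ?case using assms[of "x + p * of_int (n - 1)"] by (simp add: algebra_simps)
qed simp

section \<open>Circle diffeomorphisms and their lifts to the line\<close>

lemma carrier_Diff_plus_circle:
  "\<mu> \<in> carrier Diff_plus_circle \<longleftrightarrow> \<mu> \<in> Bij circle \<and> smooth_on circle \<mu> \<and>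
     smooth_on circle (inv_into circle \<mu>) \<and>
     (\<forall>t. \<exists>a>0. ((\<lambda>s. \<mu> (cis s)) has_vector_derivative a *\<^sub>R (\<i> * \<mu> (cis t))) (at t))"
  by (auto simp: Diff_plus_circle_def Diff_def)

lemma carrier_Diff_plus_cover:
  "\<phi> \<in> carrier Diff_plus_cover \<longleftrightarrow> bij \<phi> \<and> smooth_on UNIV \<phi> \<and> smooth_on UNIV (inv_into UNIV \<phi>) \<and>
     (\<forall>x. deriv \<phi> x > 0) \<and> (\<forall>x. \<phi> (x + 2 * pi) = \<phi> x + 2 * pi)"
  by (auto simp: Diff_plus_cover_def Diff_def Bij_def)

lemma mult_Diff_plus_circle:
  assumes "\<mu> \<in> Bij circle" "\<nu> \<in> Bij circle"
  shows "\<mu> \<otimes>\<^bsub>Diff_plus_circle\<^esub> \<nu> = compose circle \<mu> \<nu>"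
  using assms by (simp add: Diff_plus_circle_def BijGroup_def)

lemma mult_Diff_plus_cover:
  assumes "bij \<phi>" "bij \<psi>"
  shows "\<phi> \<otimes>\<^bsub>Diff_plus_cover\<^esub> \<psi> = (\<lambda>x. \<phi> (\<psi> x))"
  using assms by (simp add: Diff_plus_cover_def BijGroup_def Bij_def compose_def restrict_def)

lemma Bij_circle_norm: "\<mu> \<in> Bij circle \<Longrightarrow> norm z = 1 \<Longrightarrow> norm (\<mu> z) = 1"
  using Bij_imp_funcset[of \<mu> circle] by (auto simp: Pi_iff)

text \<open>Links the two orientation conditions: the tangent factor of a circle map is the
  derivative of its lift.\<close>

lemma has_vector_derivative_lift:
  assumes "(\<phi> has_real_derivative b) (at t)" "\<And>x. cis (\<phi> x) = m x"
  shows "(m has_vector_derivative b *\<^sub>R (\<i> * m t)) (at t)"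
proof -
  have "((\<lambda>x. cis (\<phi> x)) has_vector_derivative b *\<^sub>R (\<i> * cis (\<phi> t))) (at t)"
    using assms(1) unfolding has_vector_derivative_def has_field_derivative_def
    by (auto intro!: derivative_eq_intros simp: mult.commute)
  then show ?thesis by (simp add: assms(2))
qed

lemma smooth_on_cis: "smooth_on UNIV cis"
  by (simp add: smooth_on_UNIV Ck_on_cis)

text \<open>The map and its inverse are lifted separately; the composite of the lifts covers the
  identity, so a shift makes them mutually inverse. Orientation makes \<open>\<phi>\<close>
  increasing, and multiplicativity of the degree then forces degree one.\<close>

lemma Diff_plus_circle_lift:
  assumes \<mu>: "\<mu> \<in> carrier Diff_plus_circle"
  obtains \<phi> where "\<phi> \<in> carrier Diff_plus_cover" "\<And>x. cis (\<phi> x) = \<mu> (cis x)"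
proof -
  let ?\<mu>' = "inv_into circle \<mu>"
  have \<mu>B: "\<mu> \<in> Bij circle" and sm: "smooth_on circle \<mu>" "smooth_on circle ?\<mu>'"
    and pos: "\<And>t. \<exists>a>0. ((\<lambda>s. \<mu> (cis s)) has_vector_derivative a *\<^sub>R (\<i> * \<mu> (cis t))) (at t)"
    using \<mu> by (simp_all add: carrier_Diff_plus_circle)
  have bij: "bij_betw \<mu> circle circle" using \<mu>B by (simp add: Bij_def)
  have \<mu>\<mu>': "\<mu> (?\<mu>' z) = z" if "norm z = 1" for z
    using bij that by (simp add: bij_betw_inv_into_right)
  have n: "norm (\<mu> (cis x)) = 1" for x using Bij_circle_norm[OF \<mu>B] by simp
  have n': "norm (?\<mu>' (cis x)) = 1" for x
    using bij_betwE[OF bij_betw_inv_into[OF bij]] by auto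
  have range: "range cis \<subseteq> circle" by auto
  obtain \<phi> where \<phi>: "smooth_on UNIV \<phi>" "\<And>x. cis (\<phi> x) = \<mu> (cis x)"
    using cis_lift_exists[OF smooth_on_compose[OF smooth_on_cis sm(1) range] n] by blast
  obtain \<psi>0 where \<psi>0: "smooth_on UNIV \<psi>0" "\<And>x. cis (\<psi>0 x) = ?\<mu>' (cis x)"
    using cis_lift_exists[OF smooth_on_compose[OF smooth_on_cis sm(2) range] n'] by blast
  note cont = smooth_on_imp_continuous_on[OF \<phi>(1)] smooth_on_imp_continuous_on[OF \<psi>0(1)]
  have "cis (\<phi> (\<psi>0 x)) = cis x" for x by (simp add: \<phi> \<psi>0 \<mu>\<mu>')
  then obtain n :: int where n: "\<And>x. \<phi> (\<psi>0 x) = x + 2 * pi * of_int n"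
    using cis_lift_unique[of "\<lambda>x. \<phi> (\<psi>0 x)" "\<lambda>x. x"] cont continuous_on_compose2[OF cont(1,2)]
    by (metis continuous_on_id subset_UNIV)
  \<comment> \<open>The shift cancels the translation by which \<open>\<phi> (\<psi>0 x)\<close>
    differs from \<open>x\<close>.\<close>
  define \<psi> where "\<psi> = (\<lambda>x. \<psi>0 (x - 2 * pi * of_int n))"
  have \<phi>\<psi>: "\<phi> (\<psi> x) = x" for x by (simp add: \<psi>_def n)
  have cis\<psi>: "cis (\<psi> x) = ?\<mu>' (cis x)" for x
  proof -
    have "cis (x - 2 * pi * of_int n) = cis x"
      unfolding cis_eq_cis_iff by (intro exI[of _ "-n"]) simp
    then show ?thesis by (simp add: \<psi>_def \<psi>0)
  qed
  have "smooth_on UNIV (\<lambda>x::real. x - 2 * pi * of_int n)"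
    unfolding smooth_on_UNIV
    using Ck_on_add[OF open_UNIV Ck_on_bounded_linear[OF open_UNIV bounded_linear_ident] Ck_on_const[OF open_UNIV, of _ "- (2 * pi * of_int n)"]]
    by simp
  then have sm\<psi>: "smooth_on UNIV \<psi>"
    unfolding \<psi>_def by (rule smooth_on_compose[OF _ \<psi>0(1)]) simp
  have der: "(\<phi> has_real_derivative deriv \<phi> x) (at x)" for x
    using smooth_on_UNIV_imp_differentiable[OF \<phi>(1)]
    by (simp add: DERIV_deriv_iff_real_differentiable)
  have deriv_pos: "deriv \<phi> x > 0" for x
  proof -
    obtain a where a: "a > 0" "((\<lambda>s. \<mu> (cis s)) has_vector_derivative a *\<^sub>R (\<i> * \<mu> (cis x))) (at x)"
      using pos by blast
    from has_vector_derivative_lift[OF der \<phi>(2)] a(2)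
    have "deriv \<phi> x *\<^sub>R (\<i> * \<mu> (cis x)) = a *\<^sub>R (\<i> * \<mu> (cis x))"
      by (rule vector_derivative_unique_at)
    moreover have "\<mu> (cis x) \<noteq> 0" by (metis \<phi>(2) cis_neq_zero)
    ultimately show ?thesis using a(1) by simp
  qed
  have mono: "\<phi> x < \<phi> y" if "x < y" for x y
    using DERIV_pos_imp_increasing[OF that] der deriv_pos by blast
  then have "inj \<phi>" by (metis injI less_irrefl linorder_cases)
  then have "bij \<phi>" using \<phi>\<psi> by (metis bijI surjI)
  have inv: "inv_into UNIV \<phi> = \<psi>" using \<phi>\<psi> \<open>inj \<phi>\<close> by (metis ext inv_f_f)
  \<comment> \<open>Over one period, a continuous lift of a function of \<open>cis x\<close> gains a
    fixed integer multiple of \<open>2 * pi\<close>, its degree.\<close>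
  have per: "\<exists>d::int. \<forall>x. f (x + 2 * pi) = f x + 2 * pi * of_int d"
    if "continuous_on UNIV f" "\<And>x. cis (f x) = h (cis x)" for f h
  proof -
    have "cis (x + 2 * pi) = cis x" for x
      unfolding cis_eq_cis_iff by (intro exI[of _ 1]) simp
    then have "cis (f (x + 2 * pi)) = cis (f x)" for x by (simp add: that)
    moreover have "continuous_on UNIV (\<lambda>x. f (x + 2 * pi))"
      by (rule continuous_on_compose2[OF that(1)]) (auto intro!: continuous_intros)
    ultimately show ?thesis using cis_lift_unique[of "\<lambda>x. f (x + 2 * pi)" f] that(1) by metis
  qed
  obtain d where d: "\<And>x. \<phi> (x + 2 * pi) = \<phi> x + 2 * pi * of_int d"
    using per[OF cont(1) \<phi>(2)] by blast
  obtain e where e: "\<And>x. \<psi> (x + 2 * pi) = \<psi> x + 2 * pi * of_int e"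
    using per[OF smooth_on_imp_continuous_on[OF sm\<psi>] cis\<psi>] by blast
  \<comment> \<open>Degrees multiply under composition and the identity has degree one, so
    \<open>d\<close> is a unit; monotonicity then makes it positive.\<close>
  have "2 * pi = \<phi> (\<psi> (0 + 2 * pi))" by (simp add: \<phi>\<psi>)
  also have "\<dots> = 2 * pi * of_int (d * e)"
    unfolding e quasi_periodic_of_int[of \<phi>, OF d] by (simp add: \<phi>\<psi>)
  finally have "d * e = 1" by (simp flip: of_int_mult)
  moreover have "d > 0" using mono[of 0 "2 * pi"] d[of 0] by (simp add: zero_less_mult_iff)
  ultimately have "d = 1" by (auto simp: zmult_eq_1_iff)
  then have "\<phi> \<in> carrier Diff_plus_cover"
    using \<open>bij \<phi>\<close> \<phi>(1) sm\<psi> inv deriv_pos d by (simp add: carrier_Diff_plus_cover)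
  then show thesis using \<phi>(2) by (rule that)
qed

text \<open>\<open>cover_projection\<close> samples \<open>\<phi>\<close> only at principal
  arguments; quasi-periodicity carries the relation to every real \<open>x\<close>, and
  extensionality settles the values off the circle.\<close>

lemma cover_projection_eq_iff:
  assumes \<phi>: "\<phi> \<in> carrier Diff_plus_cover" and \<mu>: "\<mu> \<in> extensional circle"
  shows "cover_projection \<phi> = \<mu> \<longleftrightarrow> (\<forall>x. cis (\<phi> x) = \<mu> (cis x))"
proof
  assume eq: "cover_projection \<phi> = \<mu>"
  have per: "\<phi> (x + 2 * pi * of_int n) = \<phi> x + 2 * pi * of_int n" for x n
    using \<phi> quasi_periodic_of_int[of \<phi> "2 * pi"] by (simp add: carrier_Diff_plus_cover)
  show "\<forall>x. cis (\<phi> x) = \<mu> (cis x)"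
  proof
    fix x
    have "cis (Arg (cis x)) = cis x" by (simp add: cis_Arg_unit)
    then obtain n :: int where "Arg (cis x) = x + 2 * pi * of_int n"
      by (auto simp: cis_eq_cis_iff)
    then have "cis (\<phi> (Arg (cis x))) = cis (\<phi> x)"
      by (auto simp: per cis_eq_cis_iff)
    then show "cis (\<phi> x) = \<mu> (cis x)" by (simp add: eq[symmetric] cover_projection_def)
  qed
next
  assume "\<forall>x. cis (\<phi> x) = \<mu> (cis x)"
  then have "cis (\<phi> (Arg z)) = \<mu> z" if "norm z = 1" for z
    using cis_Arg_unit[OF that] by simp
  then show "cover_projection \<phi> = \<mu>"
    using \<mu> by (auto simp: cover_projection_def restrict_def extensional_def)
qed

text \<open>Smoothness passes to the composites of the maps and of their inverses. Orientation is
  read off from lifts, whose positive derivatives multiply by the chain rule.\<close>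

lemma Diff_plus_circle_mult_closed:
  assumes \<mu>: "\<mu> \<in> carrier Diff_plus_circle" and \<nu>: "\<nu> \<in> carrier Diff_plus_circle"
  shows "\<mu> \<otimes>\<^bsub>Diff_plus_circle\<^esub> \<nu> \<in> carrier Diff_plus_circle"
proof -
  have B: "\<mu> \<in> Bij circle" "\<nu> \<in> Bij circle"
    using assms by (simp_all add: carrier_Diff_plus_circle)
  then have bij: "bij_betw \<mu> circle circle" "bij_betw \<nu> circle circle"
    by (simp_all add: Bij_def)
  have sm: "smooth_on circle \<mu>" "smooth_on circle \<nu>"
    "smooth_on circle (inv_into circle \<mu>)" "smooth_on circle (inv_into circle \<nu>)"
    using assms by (simp_all add: carrier_Diff_plus_circle)
  let ?\<rho> = "compose circle \<mu> \<nu>"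
  have "smooth_on circle (\<lambda>z. \<mu> (\<nu> z))"
    using smooth_on_compose[OF sm(2,1)] bij by (simp add: bij_betw_def)
  then have "smooth_on circle ?\<rho>"
    by (rule smooth_on_cong_subset) (auto simp: compose_def)
  moreover have "smooth_on circle (inv_into circle ?\<rho>)"
  proof (rule smooth_on_cong_subset[OF _ order_refl])
    show "smooth_on circle (\<lambda>z. inv_into circle \<nu> (inv_into circle \<mu> z))"
      using smooth_on_compose[OF sm(3,4)] bij_betw_inv_into[OF bij(1)] by (simp add: bij_betw_def)
    fix z assume z: "z \<in> circle"
    let ?w = "inv_into circle \<nu> (inv_into circle \<mu> z)"
    have 1: "inv_into circle \<mu> z \<in> circle"
      using bij_betwE[OF bij_betw_inv_into[OF bij(1)]] z by blast
    then have 2: "?w \<in> circle"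
      using bij_betwE[OF bij_betw_inv_into[OF bij(2)]] by blast
    have "?\<rho> ?w = z"
      using bij_betw_inv_into_right[OF bij(2) 1] bij_betw_inv_into_right[OF bij(1) z] 2
      by (simp add: compose_def)
    moreover have "inj_on ?\<rho> circle"
      using compose_Bij[OF B] by (simp add: Bij_def bij_betw_def)
    ultimately show "?w = inv_into circle ?\<rho> z"
      using 2 by (metis inv_into_f_f)
  qed
  moreover have "\<exists>a>0. ((\<lambda>s. ?\<rho> (cis s)) has_vector_derivative a *\<^sub>R (\<i> * ?\<rho> (cis t))) (at t)" for t
  proof -
    obtain \<phi> where \<phi>: "\<phi> \<in> carrier Diff_plus_cover" "\<And>x. cis (\<phi> x) = \<mu> (cis x)"
      using Diff_plus_circle_lift[OF \<mu>] by blast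
    obtain \<psi> where \<psi>: "\<psi> \<in> carrier Diff_plus_cover" "\<And>x. cis (\<psi> x) = \<nu> (cis x)"
      using Diff_plus_circle_lift[OF \<nu>] by blast
    have der: "(f has_real_derivative deriv f x) (at x)" "deriv f x > 0"
      if "f \<in> carrier Diff_plus_cover" for f x
      using that smooth_on_UNIV_imp_differentiable[of f]
      by (simp_all add: carrier_Diff_plus_cover DERIV_deriv_iff_real_differentiable)
    have d: "((\<lambda>x. \<phi> (\<psi> x)) has_real_derivative deriv \<phi> (\<psi> t) * deriv \<psi> t) (at t)"
      using DERIV_chain2[OF der(1)[OF \<phi>(1)] der(1)[OF \<psi>(1)]] .
    have c: "cis (\<phi> (\<psi> x)) = ?\<rho> (cis x)" for x by (simp add: \<phi> \<psi> compose_def)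
    show ?thesis
      using has_vector_derivative_lift[OF d c] der(2)[OF \<phi>(1)] der(2)[OF \<psi>(1)]
      by (intro exI[of _ "deriv \<phi> (\<psi> t) * deriv \<psi> t"]) simp
  qed
  ultimately show ?thesis
    using compose_Bij[OF B] by (simp add: mult_Diff_plus_circle[OF B] carrier_Diff_plus_circle)
qed

section \<open>Degree-two cohomology\<close>

lemma H2_class_eq:
  "H2_class G c = (\<lambda>b. \<lambda>x\<in>carrier G \<times> carrier G. b x + c x) ` coboundaries2 G"
  by (auto simp: H2_class_def r_coset_def cocycle2_group_def)

lemma coboundaries2_image:
  assumes "Modules.additive t" "b \<in> coboundaries2 G"
  shows "(\<lambda>x\<in>carrier G \<times> carrier G. t (b x)) \<in> coboundaries2 G"
proof -
  interpret Modules.additive t by fact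
  from assms(2) obtain f
    where b: "b = (\<lambda>(g, h)\<in>carrier G \<times> carrier G. f h - f (g \<otimes>\<^bsub>G\<^esub> h) + f g)"
    by (auto simp: coboundaries2_def)
  show ?thesis
    unfolding coboundaries2_def b
    by (rule range_eqI[of _ _ "\<lambda>g. t (f g)"]) (auto simp: fun_eq_iff restrict_def add diff)
qed

lemma coboundaries2_add:
  assumes "b \<in> coboundaries2 G" "c \<in> coboundaries2 G"
  shows "(\<lambda>x\<in>carrier G \<times> carrier G. b x + c x) \<in> coboundaries2 G"
proof -
  from assms obtain f f'
    where b: "b = (\<lambda>(g, h)\<in>carrier G \<times> carrier G. f h - f (g \<otimes>\<^bsub>G\<^esub> h) + f g)"
      and c: "c = (\<lambda>(g, h)\<in>carrier G \<times> carrier G. f' h - f' (g \<otimes>\<^bsub>G\<^esub> h) + f' g)"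
    by (auto simp: coboundaries2_def)
  show ?thesis
    unfolding coboundaries2_def b c
    by (rule range_eqI[of _ _ "\<lambda>g. f g + f' g"]) (auto simp: fun_eq_iff restrict_def)
qed

text \<open>Translation by \<open>b\<close> takes one coset into the other and its negative leads
  back. Agreement on pairs from the group suffices, since coset members are restricted to such
  pairs.\<close>

lemma H2_class_cohomologous:
  assumes b: "b \<in> coboundaries2 G"
    and eq: "\<And>x. x \<in> carrier G \<times> carrier G \<Longrightarrow> c x = b x + d x"
  shows "H2_class G c = H2_class G d"
proof -
  let ?C = "carrier G \<times> carrier G"
  have "Modules.additive (uminus :: 'b \<Rightarrow> 'b)" by (simp add: Modules.additive_def)
  from coboundaries2_image[OF this b] have b': "(\<lambda>x\<in>?C. - b x) \<in> coboundaries2 G" .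
  have "(\<lambda>x\<in>?C. a x + c x) \<in> H2_class G d" if "a \<in> coboundaries2 G" for a
    unfolding H2_class_eq
    by (rule image_eqI[OF _ coboundaries2_add[OF that b]]) (auto simp: fun_eq_iff restrict_def eq add.assoc)
  moreover have "(\<lambda>x\<in>?C. a x + d x) \<in> H2_class G c" if "a \<in> coboundaries2 G" for a
    unfolding H2_class_eq
    by (rule image_eqI[OF _ coboundaries2_add[OF that b']]) (auto simp: fun_eq_iff restrict_def eq)
  ultimately show ?thesis
    unfolding set_eq_subset by (auto simp: H2_class_eq[of G c] H2_class_eq[of G d])
qed

text \<open>Representatives differ by coboundaries, and \<open>t\<close> maps coboundaries to
  coboundaries, so the union defining the map repeats a single class.\<close>

lemma H2_coeff_map_class:
  assumes "Modules.additive t"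
  shows "H2_coeff_map G t (H2_class G c) = H2_class G (\<lambda>x\<in>carrier G \<times> carrier G. t (c x))"
proof -
  interpret Modules.additive t by fact
  have "H2_class G (\<lambda>x\<in>carrier G \<times> carrier G. t (d x)) =
      H2_class G (\<lambda>x\<in>carrier G \<times> carrier G. t (c x))" if d: "d \<in> H2_class G c" for d
  proof -
    obtain b where b: "b \<in> coboundaries2 G" "d = (\<lambda>x\<in>carrier G \<times> carrier G. b x + c x)"
      using d by (auto simp: H2_class_eq)
    show ?thesis
      by (rule H2_class_cohomologous[OF coboundaries2_image[OF assms b(1)]]) (simp add: b(2) add)
  qed
  moreover have "H2_class G c \<noteq> {}" by (simp add: H2_class_eq coboundaries2_def)
  ultimately show ?thesis unfolding H2_coeff_map_def by blast
qed

section \<open>The Euler cocycle\<close>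

text \<open>The very section that \<open>extension_class\<close> selects in
  \<open>euler_class\<close>, named so that its cocycle can be computed with lifts.\<close>

definition section_lift :: "(complex \<Rightarrow> complex) \<Rightarrow> real \<Rightarrow> real" where
  "section_lift = (SOME s. set_section Diff_plus_circle Diff_plus_cover cover_projection s)"

text \<open>Every circle diffeomorphism has a lift, so the axiom of choice yields a section and
  \<open>SOME\<close> denotes one.\<close>

lemma section_lift:
  assumes "\<mu> \<in> carrier Diff_plus_circle"
  shows "section_lift \<mu> \<in> carrier Diff_plus_cover" "cis (section_lift \<mu> x) = \<mu> (cis x)"
proof -
  have ext: "\<mu> \<in> extensional circle" if "\<mu> \<in> carrier Diff_plus_circle" for \<mu>
    using that by (simp add: carrier_Diff_plus_circle Bij_def)
  have "\<exists>\<phi>. \<phi> \<in> carrier Diff_plus_cover \<and> cover_projection \<phi> = \<mu>"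
    if "\<mu> \<in> carrier Diff_plus_circle" for \<mu>
    using Diff_plus_circle_lift[OF that] cover_projection_eq_iff ext[OF that] by metis
  then obtain s where "\<And>\<mu>. \<mu> \<in> carrier Diff_plus_circle \<Longrightarrow>
      s \<mu> \<in> carrier Diff_plus_cover \<and> cover_projection (s \<mu>) = \<mu>"
    by metis
  then have "set_section Diff_plus_circle Diff_plus_cover cover_projection s"
    by (auto simp: set_section_def)
  then have "set_section Diff_plus_circle Diff_plus_cover cover_projection section_lift"
    unfolding section_lift_def by (rule someI[of "set_section _ _ _"])
  then have s: "section_lift \<mu> \<in> carrier Diff_plus_cover" "cover_projection (section_lift \<mu>) = \<mu>"
    using assms by (auto simp: set_section_def)
  then show "section_lift \<mu> \<in> carrier Diff_plus_cover" "cis (section_lift \<mu> x) = \<mu> (cis x)"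
    using cover_projection_eq_iff[OF s(1) ext[OF assms]] by auto
qed

lemma cover_has_derivative:
  assumes "\<phi> \<in> carrier Diff_plus_cover"
  shows "(\<phi> has_real_derivative deriv \<phi> x) (at x)"
  using assms smooth_on_UNIV_imp_differentiable[of \<phi>]
  by (simp add: carrier_Diff_plus_cover DERIV_deriv_iff_real_differentiable)

lemma continuous_on_cover: "\<phi> \<in> carrier Diff_plus_cover \<Longrightarrow> continuous_on UNIV \<phi>"
  by (simp add: carrier_Diff_plus_cover smooth_on_imp_continuous_on)

text \<open>The composite of the lifts and the lift of the product cover the same circle map, hence
  differ by a unique integer translation, which is the number that \<open>THE\<close> selects in
  \<open>extension_cocycle\<close>.\<close>

lemma section_lift_mult:
  assumes \<mu>: "\<mu> \<in> carrier Diff_plus_circle" and \<nu>: "\<nu> \<in> carrier Diff_plus_circle"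
  shows "section_lift \<mu> (section_lift \<nu> x) = section_lift (\<mu> \<otimes>\<^bsub>Diff_plus_circle\<^esub> \<nu>) x +
    2 * pi * of_int (extension_cocycle Diff_plus_circle Diff_plus_cover cover_inclusion section_lift (\<mu>, \<nu>))"
proof -
  let ?\<rho> = "\<mu> \<otimes>\<^bsub>Diff_plus_circle\<^esub> \<nu>"
  have \<rho>: "?\<rho> \<in> carrier Diff_plus_circle" by (rule Diff_plus_circle_mult_closed[OF assms])
  note s\<mu> = section_lift[OF \<mu>] and s\<nu> = section_lift[OF \<nu>] and s\<rho> = section_lift[OF \<rho>]
  have bij: "bij (section_lift \<mu>)" "bij (section_lift \<nu>)" "bij (section_lift ?\<rho>)"
    using s\<mu>(1) s\<nu>(1) s\<rho>(1) by (simp_all add: carrier_Diff_plus_cover)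
  have "bij (cover_inclusion n)" for n
    unfolding cover_inclusion_def
    by (rule bij_betw_byWitness[where f'="\<lambda>x. x - 2 * pi * of_int n"]) auto
  then have eq: "section_lift \<mu> \<otimes>\<^bsub>Diff_plus_cover\<^esub> section_lift \<nu> =
        cover_inclusion n \<otimes>\<^bsub>Diff_plus_cover\<^esub> section_lift ?\<rho> \<longleftrightarrow>
      (\<forall>x. section_lift \<mu> (section_lift \<nu> x) = section_lift ?\<rho> x + 2 * pi * of_int n)" for n
    by (simp add: mult_Diff_plus_cover bij fun_eq_iff) (simp add: cover_inclusion_def)
  have "?\<rho> (cis x) = \<mu> (\<nu> (cis x))" for x
    using \<mu> \<nu> by (simp add: carrier_Diff_plus_circle mult_Diff_plus_circle compose_def)
  then have "cis (section_lift \<mu> (section_lift \<nu> x)) = cis (section_lift ?\<rho> x)" for x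
    by (simp add: s\<mu> s\<nu> s\<rho>)
  then obtain n where n: "\<And>x. section_lift \<mu> (section_lift \<nu> x) = section_lift ?\<rho> x + 2 * pi * of_int n"
    using cis_lift_unique[of "\<lambda>x. section_lift \<mu> (section_lift \<nu> x)" "section_lift ?\<rho>"]
      continuous_on_compose2[OF continuous_on_cover[OF s\<mu>(1)] continuous_on_cover[OF s\<nu>(1)]]
      continuous_on_cover[OF s\<rho>(1)] by blast
  have "extension_cocycle Diff_plus_circle Diff_plus_cover cover_inclusion section_lift (\<mu>, \<nu>) = n"
    using \<mu> \<nu> n by (auto simp: extension_cocycle_def eq intro!: the_equality)
  then show ?thesis using n by simp
qed

text \<open>This is \<open>pi\<close> times the familiar real representative of the Euler class,
  evaluated on the chosen lifts; dividing by \<open>2\<close> rather than \<open>2 * pi\<close>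
  absorbs the factor.\<close>

definition euler_cochain :: "(complex \<Rightarrow> complex) \<times> (complex \<Rightarrow> complex) \<Rightarrow> real" where
  "euler_cochain = (\<lambda>(\<mu>, \<nu>)\<in>carrier Diff_plus_circle \<times> carrier Diff_plus_circle.
     (section_lift \<mu> (section_lift \<nu> 0) - section_lift \<mu> 0 - section_lift \<nu> 0) / 2)"

text \<open>Rewriting lifts of products as composites introduces integer translations, each
  occurring twice with opposite signs; the composites themselves cancel in pairs.\<close>

lemma euler_cochain_cocycle: "euler_cochain \<in> cocycles2 Diff_plus_circle"
proof -
  let ?G = "Diff_plus_circle"
  have "euler_cochain (h, k) - euler_cochain (g \<otimes>\<^bsub>?G\<^esub> h, k) +
      euler_cochain (g, h \<otimes>\<^bsub>?G\<^esub> k) - euler_cochain (g, h) = 0"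
    if G: "g \<in> carrier ?G" "h \<in> carrier ?G" "k \<in> carrier ?G" for g h k
  proof -
    let ?n = "extension_cocycle ?G Diff_plus_cover cover_inclusion section_lift"
    have per: "section_lift g (x + 2 * pi * of_int n) = section_lift g x + 2 * pi * of_int n" for x n
      using section_lift(1)[OF G(1)] quasi_periodic_of_int[of "section_lift g" "2 * pi"]
      by (simp add: carrier_Diff_plus_cover)
    have hk: "section_lift (h \<otimes>\<^bsub>?G\<^esub> k) 0 = section_lift h (section_lift k 0) - 2 * pi * of_int (?n (h, k))"
      using section_lift_mult[OF G(2,3)] by simp
    have gh: "section_lift (g \<otimes>\<^bsub>?G\<^esub> h) x = section_lift g (section_lift h x) - 2 * pi * of_int (?n (g, h))" for x
      using section_lift_mult[OF G(1,2)] by simp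
    \<comment> \<open>The translation from the product of \<open>h\<close> and \<open>k\<close>
      passes through the lift of \<open>g\<close> by quasi-periodicity.\<close>
    have g_hk: "section_lift g (section_lift (h \<otimes>\<^bsub>?G\<^esub> k) 0) =
        section_lift g (section_lift h (section_lift k 0)) - 2 * pi * of_int (?n (h, k))"
      using per[of "section_lift h (section_lift k 0)" "- ?n (h, k)"] by (simp add: hk)
    show ?thesis
      using G Diff_plus_circle_mult_closed by (simp add: euler_cochain_def gh g_hk) (simp add: hk field_simps)
  qed
  then show ?thesis by (auto simp: cocycles2_def euler_cochain_def)
qed

lemma H2_class_euler_cochain:
  "H2_class Diff_plus_circle euler_cochain = H2_coeff_map Diff_plus_circle ((*) pi) real_euler_class"
proof -
  let ?G = "Diff_plus_circle"
  let ?n = "extension_cocycle ?G Diff_plus_cover cover_inclusion section_lift"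
  \<comment> \<open>Chosen so that its coboundary is the discrepancy between
    \<open>euler_cochain\<close> and \<open>pi\<close> times the extension cocycle.\<close>
  let ?f = "\<lambda>g. - section_lift g 0 / 2"
  let ?b = "\<lambda>(g, h)\<in>carrier ?G \<times> carrier ?G. ?f h - ?f (g \<otimes>\<^bsub>?G\<^esub> h) + ?f g"
  have "Modules.additive real_of_int" "Modules.additive ((*) pi)"
    by (simp_all add: Modules.additive_def distrib_left)
  then have "H2_coeff_map ?G ((*) pi) real_euler_class =
      H2_class ?G (\<lambda>x\<in>carrier ?G \<times> carrier ?G. pi * (\<lambda>x\<in>carrier ?G \<times> carrier ?G. real_of_int (?n x)) x)"
    unfolding real_euler_class_def euler_class_def extension_class_def section_lift_def
    by (simp only: H2_coeff_map_class)
  also have "\<dots> = H2_class ?G euler_cochain"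
  proof (rule H2_class_cohomologous[symmetric])
    show "?b \<in> coboundaries2 ?G" unfolding coboundaries2_def by (rule rangeI)
    fix x assume "x \<in> carrier ?G \<times> carrier ?G"
    then show "euler_cochain x = ?b x +
        (\<lambda>x\<in>carrier ?G \<times> carrier ?G. pi * (\<lambda>x\<in>carrier ?G \<times> carrier ?G. real_of_int (?n x)) x) x"
      using section_lift_mult[of "fst x" "snd x" 0]
      by (auto simp: euler_cochain_def field_simps)
  qed
  finally show ?thesis ..
qed

section \<open>Symplectomorphisms of the disk\<close>

text \<open>By invariance of domain the image of the open ball is open, so it lies in the interior
  of the closed ball. The same for the inverse shows that the open ball is preserved, and the sphere
  is its complement.\<close>

lemma bij_betw_sphere_of_cball:
  fixes f :: "'a::euclidean_space \<Rightarrow> 'a"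
  assumes bij: "bij_betw f (cball a r) (cball a r)"
    and cont: "continuous_on (cball a r) f" "continuous_on (cball a r) (inv_into (cball a r) f)"
  shows "bij_betw f (sphere a r) (sphere a r)"
proof -
  have ball: "g ` ball a r \<subseteq> ball a r"
    if "continuous_on (cball a r) g" "bij_betw g (cball a r) (cball a r)" for g :: "'a \<Rightarrow> 'a"
  proof -
    have "open (g ` ball a r)"
      using that ball_subset_cball
      by (intro invariance_of_domain) (auto intro: continuous_on_subset inj_on_subset simp: bij_betw_def)
    moreover have "g ` ball a r \<subseteq> cball a r"
      using that(2) ball_subset_cball by (auto simp: bij_betw_def)
    ultimately show ?thesis using interior_maximal[of "g ` ball a r" "cball a r"] by simp
  qed
  have "f ` ball a r = ball a r"
  proof
    show "f ` ball a r \<subseteq> ball a r" by (rule ball[OF cont(1) bij])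
    have "inv_into (cball a r) f ` ball a r \<subseteq> ball a r"
      by (rule ball[OF cont(2) bij_betw_inv_into[OF bij]])
    moreover have "f (inv_into (cball a r) f y) = y" if "y \<in> ball a r" for y
      using bij_betw_inv_into_right[OF bij] that ball_subset_cball by blast
    ultimately show "ball a r \<subseteq> f ` ball a r" by (metis image_eqI image_subset_iff subsetI)
  qed
  moreover have "sphere a r = cball a r - ball a r" by auto
  ultimately show ?thesis
    using bij ball_subset_cball[of a r] unfolding bij_betw_def
    by (metis Diff_subset inj_on_image_set_diff inj_on_subset)
qed

lemma carrier_Symp_disk:
  "g \<in> carrier Symp_disk \<longleftrightarrow> g \<in> Bij disk \<and> smooth_on disk g \<and> smooth_on disk (inv_into disk g) \<and>
     (\<forall>z\<in>disk. pullback2 g area_form z = area_form z)"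
  by (auto simp: Symp_disk_def Diff_def)

lemma interior_disk: "interior disk \<noteq> {}" by simp

lemma disk_has_derivative:
  assumes "smooth_on disk g" "z \<in> disk"
  shows "(g has_derivative frechet_derivative g (at z within disk)) (at z within disk)"
  by (rule smooth_on_has_derivative[OF assms(1) convex_cball interior_disk assms(2)])

text \<open>A derivative within the disk yields a full derivative in \<open>t\<close>, because the
  curve \<open>cis\<close> never leaves the disk.\<close>

lemma has_vector_derivative_along_circle:
  assumes "(P has_derivative P') (at (cis t) within disk)"
  shows "((\<lambda>s. P (cis s)) has_vector_derivative P' (\<i> * cis t)) (at t)"
proof -
  have "(cis has_vector_derivative \<i> * cis t) (at t)"
    unfolding has_vector_derivative_def by (rule has_derivative_cis[OF has_derivative_ident])
  moreover have "(P has_derivative P') (at (cis t) within range cis)"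
    by (rule has_derivative_subset[OF assms]) auto
  ultimately show ?thesis
    using vector_derivative_diff_chain_within[of cis _ t UNIV P P'] by (simp add: o_def)
qed

text \<open>Once the circle is known to be invariant, orientation remains. By area preservation the
  tangential factor times the radial component of the derivative is \<open>1\<close>; the radial
  component cannot be negative because \<open>g\<close> maps into the disk, so the tangential factor
  is positive.\<close>

lemma Symp_disk_boundary:
  assumes g: "g \<in> carrier Symp_disk"
  shows "boundary_restriction g \<in> carrier Diff_plus_circle"
proof -
  let ?g' = "inv_into disk g" and ?\<mu> = "restrict g circle"
  have sm: "smooth_on disk g" "smooth_on disk ?g'" and bij: "bij_betw g disk disk"
    and area: "\<And>z. z \<in> disk \<Longrightarrow> pullback2 g area_form z = area_form z"
    using g by (auto simp: carrier_Symp_disk Bij_def)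
  have bij_c: "bij_betw g circle circle"
    using bij_betw_sphere_of_cball[OF bij] sm smooth_on_imp_continuous_on by blast
  then have "bij_betw ?\<mu> circle circle"
    by (subst bij_betw_cong[of circle ?\<mu> g]) auto
  then have B: "?\<mu> \<in> Bij circle" by (simp add: Bij_def)
  have sm1: "smooth_on circle ?\<mu>" by (rule smooth_on_cong_subset[OF sm(1)]) auto
  have sm2: "smooth_on circle (inv_into circle ?\<mu>)"
  proof (rule smooth_on_cong_subset[OF sm(2)])
    fix w assume "w \<in> circle"
    then have "w \<in> g ` circle" using bij_c by (simp only: bij_betw_def)
    then obtain z where z: "w = g z" "z \<in> circle" by (rule imageE)
    then have "inv_into circle ?\<mu> w = z"
      using B by (auto simp: Bij_def bij_betw_def intro: inv_into_f_eq)
    moreover have "?g' w = z"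
      using z bij by (auto simp: bij_betw_def intro: inv_into_f_eq)
    ultimately show "?g' w = inv_into circle ?\<mu> w" by simp
  qed auto
  have n: "norm (g (cis s)) = 1" for s using bij_betwE[OF bij_c] by auto
  have "range cis \<subseteq> disk" by auto
  then obtain \<phi> where \<phi>: "smooth_on UNIV \<phi>" "\<And>x. cis (\<phi> x) = g (cis x)"
    using cis_lift_exists[OF smooth_on_compose[OF smooth_on_cis sm(1)] n] by blast
  have "\<exists>a>0. ((\<lambda>s. ?\<mu> (cis s)) has_vector_derivative a *\<^sub>R (\<i> * ?\<mu> (cis t))) (at t)" for t
  proof -
    define z where "z = cis t"
    have z: "z \<in> disk" "norm z = 1" by (simp_all add: z_def)
    define D where "D = frechet_derivative g (at z within disk)"
    have D: "(g has_derivative D) (at z within disk)"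
      unfolding D_def by (rule disk_has_derivative[OF sm(1) z(1)])
    have "(\<phi> has_real_derivative deriv \<phi> t) (at t)"
      using smooth_on_UNIV_imp_differentiable[OF \<phi>(1)] by (simp add: DERIV_deriv_iff_real_differentiable)
    from has_vector_derivative_lift[OF this \<phi>(2)]
    have m': "((\<lambda>s. g (cis s)) has_vector_derivative deriv \<phi> t *\<^sub>R (\<i> * g z)) (at t)"
      by (simp add: z_def)
    then have Diz: "D (\<i> * z) = deriv \<phi> t *\<^sub>R (\<i> * g z)"
      using has_vector_derivative_along_circle[of g D t] D vector_derivative_unique_at z_def by blast
    \<comment> \<open>Otherwise moving inward from \<open>z\<close> would raise the squared norm of
      \<open>g\<close> above its boundary value \<open>1\<close>.\<close>
    have "g z \<bullet> D z \<ge> 0"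
    proof (rule ccontr)
      assume neg: "\<not> ?thesis"
      let ?r = "\<lambda>s::real. (1 - s) *\<^sub>R z"
      have rd: "?r ` {0..1} \<subseteq> disk" using z by auto
      have "(?r has_vector_derivative (- z)) (at 0 within {0..1})"
        by (auto intro!: derivative_eq_intros)
      moreover have "(g has_derivative D) (at (?r 0) within ?r ` {0..1})"
        using has_derivative_subset[OF D rd] by simp
      ultimately have "(g \<circ> ?r has_vector_derivative D (- z)) (at 0 within {0..1})"
        by (rule vector_derivative_diff_chain_within)
      from bounded_bilinear.has_vector_derivative[OF bounded_bilinear_inner this this]
      have "((\<lambda>s. g (?r s) \<bullet> g (?r s)) has_real_derivative g z \<bullet> D (- z) + D (- z) \<bullet> g z) (at 0 within {0..1})"
        by (simp add: has_real_derivative_iff_has_vector_derivative)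
      moreover have "g z \<bullet> D (- z) + D (- z) \<bullet> g z > 0"
        using neg linear_neg[OF has_derivative_linear[OF D]] by (simp add: inner_commute)
      ultimately obtain d where d: "d > 0"
        "\<And>h. h > 0 \<Longrightarrow> 0 + h \<in> {0..1} \<Longrightarrow> h < d \<Longrightarrow> g (?r 0) \<bullet> g (?r 0) < g (?r (0 + h)) \<bullet> g (?r (0 + h))"
        using has_real_derivative_pos_inc_right by blast
      \<comment> \<open>The minimum keeps the point on the radius, and half of \<open>d\<close>
        stays below \<open>d\<close>.\<close>
      define h where "h = min 1 (d / 2)"
      have "g (?r 0) \<bullet> g (?r 0) < g (?r (0 + h)) \<bullet> g (?r (0 + h))"
        using d(1) by (intro d(2)) (auto simp: h_def)
      moreover have "g (?r 0) \<bullet> g (?r 0) = 1" using n[of t] by (simp add: z_def norm_eq_1)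
      moreover have "?r (0 + h) \<in> disk"
        using d(1) by (intro subsetD[OF rd] imageI) (auto simp: h_def)
      then have "norm (g (?r (0 + h))) \<le> 1" using bij_betwE[OF bij] by auto
      then have "g (?r (0 + h)) \<bullet> g (?r (0 + h)) \<le> 1" by (simp add: dot_square_norm power_le_one)
      ultimately show False by simp
    qed
    \<comment> \<open>The area identity is tested on the radial vector \<open>z\<close> and the
      tangent vector \<open>\<i> * z\<close>, which span unit area.\<close>
    moreover have "deriv \<phi> t * (g z \<bullet> D z) = 1"
    proof -
      have "area_form (g z) (D z) (D (\<i> * z)) = area_form z z (\<i> * z)"
        using area[OF z(1)] by (metis D_def pullback2_def)
      then show ?thesis
        using z(2) by (simp add: Diz area_form_def inner_complex_def norm_complex_def power2_eq_square algebra_simps)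
    qed
    ultimately have "deriv \<phi> t > 0"
      by (metis less_irrefl mult_nonneg_nonneg mult_zero_left not_less order_antisym_conv zero_less_mult_iff zero_less_one)
    then show ?thesis using m' by (auto simp: z_def)
  qed
  then show ?thesis
    using B sm1 sm2 by (simp add: boundary_restriction_def carrier_Diff_plus_circle)
qed

section \<open>The primitive on the disk and the values of the ILM cocycle\<close>

lemma bounded_bilinear_eta_form: "bounded_bilinear eta_form"
proof
  show "\<exists>K. \<forall>a b. norm (eta_form a b) \<le> norm a * norm b * K"
  proof (intro exI allI)
    fix a b
    have "\<bar>Re a * Im b\<bar> \<le> norm a * norm b" "\<bar>Im a * Re b\<bar> \<le> norm a * norm b"
      unfolding abs_mult by (intro mult_mono abs_Re_le_cmod abs_Im_le_cmod norm_ge_zero abs_ge_zero)+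
    then show "norm (eta_form a b) \<le> norm a * norm b * 1" by (simp add: eta_form_def)
  qed
qed (simp_all add: eta_form_def field_simps)

text \<open>For closedness, antisymmetrise the derivative of the form: the second derivatives of
  \<open>g\<close> cancel by symmetry. Antisymmetrising \<open>eta_form\<close> gives
  \<open>area_form\<close>, so what remains is the pulled-back area form minus the area form, which
  vanishes.\<close>

lemma ILM_form_has_primitive:
  assumes g: "g \<in> carrier Symp_disk"
  obtains P where "\<And>z. z \<in> disk \<Longrightarrow>
    (P has_derivative (\<lambda>v. pullback1 g eta_form z v - eta_form z v)) (at z within disk)"
proof -
  define D where "D = (\<lambda>z. frechet_derivative g (at z within disk))"
  define D2 where "D2 = (\<lambda>z v. frechet_derivative (\<lambda>y. D y v) (at z within disk))"
  have sm: "smooth_on disk g"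
    and area: "\<And>z. z \<in> disk \<Longrightarrow> pullback2 g area_form z = area_form z"
    using g by (auto simp: carrier_Symp_disk)
  note sm_D = smooth_on_frechet_derivative[OF _ convex_cball interior_disk]
  have smD: "smooth_on disk (\<lambda>z. D z v)" for v
    unfolding D_def by (rule sm_D[OF sm])
  have smD2: "smooth_on disk (\<lambda>z. D2 z v u)" for v u
    unfolding D2_def by (rule sm_D[OF smD])
  have D: "(g has_derivative D z) (at z within disk)" if "z \<in> disk" for z
    unfolding D_def by (rule disk_has_derivative[OF sm that])
  have D2: "((\<lambda>y. D y v) has_derivative D2 z v) (at z within disk)" if "z \<in> disk" for z v
    unfolding D2_def by (rule disk_has_derivative[OF smD that])
  have sym: "D2 z u v = D2 z v u" if "z \<in> disk" for z u v
    unfolding D2_def D_def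
    by (rule smooth_on_symmetric_second_derivative[OF sm convex_cball interior_disk that])
  interpret eta: bounded_bilinear eta_form by (rule bounded_bilinear_eta_form)
  let ?\<theta> = "\<lambda>z v. eta_form (g z) (D z v) - eta_form z v"
  \<comment> \<open>The derivative in direction \<open>u\<close> with \<open>v\<close> frozen, by
    the product rule for \<open>eta_form\<close>.\<close>
  let ?\<theta>' = "\<lambda>z v u. eta_form (g z) (D2 z v u) + eta_form (D z u) (D z v) - eta_form u v"
  obtain P where "\<And>z. z \<in> disk \<Longrightarrow> (P has_derivative ?\<theta> z) (at z within disk)"
  proof (rule closed_one_form_has_primitive[of disk ?\<theta> ?\<theta>'])
    fix z assume z: "z \<in> disk"
    show "linear (?\<theta> z)"
      using has_derivative_linear[OF D[OF z]]
      by (intro linearI) (simp_all add: linear_add linear_scale eta.add_right eta.scaleR_right algebra_simps)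
    fix v
    have "((\<lambda>z. eta_form z v) has_derivative (\<lambda>u. eta_form u v)) (at z within disk)"
      by (intro bounded_linear_imp_has_derivative eta.bounded_linear_left)
    with eta.FDERIV[OF D[OF z] D2[OF z]]
    show "((\<lambda>z. ?\<theta> z v) has_derivative ?\<theta>' z v) (at z within disk)"
      by (rule has_derivative_diff)
    fix u
    have "area_form (g z) (D z u) (D z v) = area_form z u v"
      using area[OF z] by (metis D_def pullback2_def)
    then show "?\<theta>' z u v = ?\<theta>' z v u"
      by (simp add: sym[OF z, of u v] area_form_def eta_form_def field_simps)
  next
    fix u v
    show "continuous_on disk (\<lambda>z. ?\<theta>' z u v)"
      by (intro continuous_intros eta.continuous_on smooth_on_imp_continuous_on sm smD smD2)
  qed auto
  then show thesis by (intro that) (simp add: pullback1_def D_def)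
qed

lemma ILM_cocycle_eq:
  assumes g: "g \<in> carrier Symp_disk" and h: "h \<in> carrier Symp_disk"
  defines "\<phi> \<equiv> section_lift (boundary_restriction g)"
    and "\<psi> \<equiv> section_lift (boundary_restriction h)"
  shows "ILM_cocycle eta_form 1 (g, h) = (\<phi> (\<psi> 0) - \<phi> 0 - \<psi> 0) / 2"
proof -
  let ?\<theta> = "\<lambda>z v. pullback1 g eta_form z v - eta_form z v"
  obtain P where P: "\<And>z. z \<in> disk \<Longrightarrow> (P has_derivative ?\<theta> z) (at z within disk)"
    using ILM_form_has_primitive[OF g] by blast
  have \<phi>: "\<phi> \<in> carrier Diff_plus_cover" "cis (\<phi> x) = g (cis x)" for x
    using section_lift[OF Symp_disk_boundary[OF g]]
    by (simp_all add: \<phi>_def boundary_restriction_def)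
  have \<psi>: "cis (\<psi> x) = h (cis x)" for x
    using section_lift(2)[OF Symp_disk_boundary[OF h]]
    by (simp add: \<psi>_def boundary_restriction_def)
  have h1: "h 1 = cis (\<psi> 0)" using \<psi>[of 0] by simp
  have int: "has_line_integral ?\<theta> (P (h 1) - P 1) \<gamma>"
    if "valid_path \<gamma>" "path_image \<gamma> \<subseteq> disk" "pathstart \<gamma> = 1" "pathfinish \<gamma> = h 1" for \<gamma>
    using has_line_integral_primitive[OF P that(1,2)] that(3,4) by simp
  \<comment> \<open>The segment is an admissible path in the convex disk, so at most one number can
    satisfy the condition under \<open>THE\<close>.\<close>
  have "path_image (linepath 1 (h 1)) \<subseteq> disk"
    by (simp add: closed_segment_subset h1)
  then have "(THE c. \<forall>\<gamma>. valid_path \<gamma> \<and> path_image \<gamma> \<subseteq> disk \<and> pathstart \<gamma> = 1 \<and> pathfinish \<gamma> = h 1 \<longrightarrow>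
      has_line_integral ?\<theta> c \<gamma>) = P (h 1) - P 1"
    using int by (intro the_equality)
      (auto simp: has_line_integral_def dest!: spec[of _ "linepath 1 (h 1)"] intro: has_integral_unique)
  then have "ILM_cocycle eta_form 1 (g, h) = P (cis (\<psi> 0)) - P (cis 0)"
    using g h by (simp add: ILM_cocycle_def h1)
  also have "\<dots> = (\<phi> (\<psi> 0) - \<phi> 0 - \<psi> 0) / 2"
  proof -
    \<comment> \<open>On the unit tangent vector of the circle the form takes the value
      \<open>(deriv \<phi> s - 1) / 2\<close>, which is also the derivative of
      \<open>(\<phi> s - s) / 2\<close>.\<close>
    have "((\<lambda>s. P (cis s) - (\<phi> s - s) / 2) has_real_derivative 0) (at s)" for s
    proof -
      let ?z = "cis s"
      let ?D = "frechet_derivative g (at ?z within disk)"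
      have sm: "smooth_on disk g" using g by (simp add: carrier_Symp_disk)
      note d\<phi> = cover_has_derivative[OF \<phi>(1)]
      have "(g has_derivative ?D) (at ?z within disk)"
        by (rule disk_has_derivative[OF sm]) simp
      \<comment> \<open>Both sides are the velocity of \<open>g (cis s)\<close>, computed once
        through the disk and once through the lift.\<close>
      then have "?D (\<i> * ?z) = deriv \<phi> s *\<^sub>R (\<i> * g ?z)"
        by (intro vector_derivative_unique_at[OF has_vector_derivative_along_circle
              has_vector_derivative_lift[OF d\<phi> \<phi>(2)]])
      then have "pullback1 g eta_form ?z (\<i> * ?z) = eta_form (cis (\<phi> s)) (deriv \<phi> s *\<^sub>R (\<i> * cis (\<phi> s)))"
        by (simp add: pullback1_def \<phi>(2))
      also have "\<dots> = deriv \<phi> s * ((cos (\<phi> s))\<^sup>2 + (sin (\<phi> s))\<^sup>2) / 2"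
        by (simp add: eta_form_def power2_eq_square field_simps del: sin_cos_squared_add2 sin_cos_squared_add sin_cos_squared_add3)
      also have "\<dots> = deriv \<phi> s / 2" by simp
      finally have "pullback1 g eta_form ?z (\<i> * ?z) = deriv \<phi> s / 2" .
      moreover have "eta_form ?z (\<i> * ?z) = ((cos s)\<^sup>2 + (sin s)\<^sup>2) / 2"
        by (simp add: eta_form_def power2_eq_square)
      ultimately have \<theta>: "?\<theta> ?z (\<i> * ?z) = (deriv \<phi> s - 1) / 2"
        by (simp add: diff_divide_distrib)
      have "((\<lambda>s. P (cis s)) has_vector_derivative ?\<theta> ?z (\<i> * ?z)) (at s)"
        by (intro has_vector_derivative_along_circle P) simp
      then have "((\<lambda>s. P (cis s)) has_real_derivative (deriv \<phi> s - 1) / 2) (at s)"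
        by (simp only: \<theta> has_real_derivative_iff_has_vector_derivative)
      then show ?thesis using d\<phi> by (auto intro!: derivative_eq_intros)
    qed
    then have "P (cis (\<psi> 0)) - (\<phi> (\<psi> 0) - \<psi> 0) / 2 = P (cis 0) - (\<phi> 0 - 0) / 2"
      using DERIV_isconst_all[of "\<lambda>s. P (cis s) - (\<phi> s - s) / 2" "\<psi> 0" 0] by blast
    then show ?thesis by (simp add: field_simps)
  qed
  finally show ?thesis .
qed

theorem theoremB:
  shows "\<exists>chi \<in> cocycles2 Diff_plus_circle.
           ILM_cocycle eta_form 1 = pullback_cochain2 Symp_disk boundary_restriction chi \<and>
           H2_class Diff_plus_circle chi = H2_coeff_map Diff_plus_circle ((*) pi) real_euler_class"
proof (intro bexI conjI)
  \<comment> \<open>This goal fixes \<open>euler_cochain\<close> as the witness for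
    \<open>chi\<close>.\<close>
  show "ILM_cocycle eta_form 1 = pullback_cochain2 Symp_disk boundary_restriction euler_cochain"
  proof
    fix x
    show "ILM_cocycle eta_form 1 x = pullback_cochain2 Symp_disk boundary_restriction euler_cochain x"
    proof (cases "x \<in> carrier Symp_disk \<times> carrier Symp_disk")
      case True
      then show ?thesis
        by (auto simp: ILM_cocycle_eq pullback_cochain2_def euler_cochain_def Symp_disk_boundary)
    next
      case False
      \<comment> \<open>Off the pairs of symplectomorphisms both restricted functions take the value
        \<open>undefined\<close>.\<close>
      then show ?thesis by (simp add: ILM_cocycle_def pullback_cochain2_def restrict_def)
    qed
  qed
qed (rule H2_class_euler_cochain euler_cochain_cocycle)+

end
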